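(* Let $A$ be a finite-dimensional formally real Jordan algebra with unit $u$ and symmetric cone $A_+^\circ$. The horofunctions of $(A_+^\circ,d_T)$ (basepoint $u$) are precisely the functions of the form $$h(x)=\max\{\log M(y/x),\ \log M(z/x^{-1})\},\qquad x\in A_+^\circ,$$ where $y,z\in A_+$ satisfy $y\bullet z=0$ and $\max\{\|y\|_u,\|z\|_u\}=1$, with the convention that if $y=0$ or $z=0$ then the corresponding term is omitted from the maximum. Moreover, each horofunction is a Busemann point.
   Context: $A$: finite-dimensional real vector space with commutative bilinear product $\bullet$ satisfying $x^2\bullet(x\bullet y)=x\bullet(x^2\bullet y)$, formally real ($x^2+y^2=0\Rightarrow x=y=0$), unit $u$. $A_+=\{x^2:x\in A\}$, $A_+^\circ$ its interior, $x\le y$ iff $y-x\in A_+$. $\|x\|_u=\max\{|\lambda|:\lambda\in\sigma(x)\}$; $x^{-1}$ is the Jordan inverse. For $x\in A$, $y\in A_+^\circ$, $M(x/y)=\inf\{\beta:x\le\beta y\}$. Thompson distance: $d_T(x,y)=\max\{\log M(x/y),\log M(y/x)\}$ on $A_+^\circ$. Horofunction compactification with basepoint $u$: closure of $\{h_w:w\in A_+^\circ\}$, $h_w(x)=d_T(x,w)-d_T(u,w)$, in $\mathbb{R}^{A_+^\circ}$ with pointwise convergence; horofunctions are the limit points not of the form $h_w$. A path $\gamma\colon T\to A_+^\circ$ ($T\subseteq[0,\infty)$ unbounded, $0\in T$) is an almost geodesic if for every $\varepsilon>0$ there is $N$ with $|d_T(\gamma(t),\gamma(s))+d_T(\gamma(s),\gamma(0))-t|<\varepsilon$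 for all $t\ge s\ge N$ in $T$; a Busemann point is a horofunction which is the limit $\lim_{t\to\infty}h_{\gamma(t)}$ of an almost geodesic. *)

theory Defs
  imports "HOL-Analysis.Analysis"
begin

definition formally_real_jordan :: "('a::euclidean_space \<Rightarrow> 'a \<Rightarrow> 'a) \<Rightarrow> 'a \<Rightarrow> bool" where
  "formally_real_jordan m u \<longleftrightarrow>
     bilinear m \<and>
     (\<forall>x y. m x y = m y x) \<and>
     (\<forall>x y. m (m x x) (m x y) = m x (m (m x x) y)) \<and>
     (\<forall>x y. m x x + m y y = 0 \<longrightarrow> x = 0 \<and> y = 0) \<and>
     (\<forall>x. m u x = x)"

definition jinvertible :: "('a::euclidean_space \<Rightarrow> 'a \<Rightarrow> 'a) \<Rightarrow> 'a \<Rightarrow> 'a \<Rightarrow> bool" where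
  "jinvertible m u x \<longleftrightarrow> (\<exists>y. m x y = u \<and> m (m x x) y = x)"

definition jinv :: "('a::euclidean_space \<Rightarrow> 'a \<Rightarrow> 'a) \<Rightarrow> 'a \<Rightarrow> 'a \<Rightarrow> 'a" where
  "jinv m u x = (THE y. m x y = u \<and> m (m x x) y = x)"

definition jspectrum :: "('a::euclidean_space \<Rightarrow> 'a \<Rightarrow> 'a) \<Rightarrow> 'a \<Rightarrow> 'a \<Rightarrow> real set" where
  "jspectrum m u x = {l. \<not> jinvertible m u (x - l *\<^sub>R u)}"

definition unorm :: "('a::euclidean_space \<Rightarrow> 'a \<Rightarrow> 'a) \<Rightarrow> 'a \<Rightarrow> 'a \<Rightarrow> real" where
  "unorm m u x = Max (abs ` jspectrum m u x)"

definition cone :: "('a::euclidean_space \<Rightarrow> 'a \<Rightarrow> 'a) \<Rightarrow> 'a set" where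
  "cone m = {m x x | x. True}"

definition icone :: "('a::euclidean_space \<Rightarrow> 'a \<Rightarrow> 'a) \<Rightarrow> 'a set" where
  "icone m = interior (cone m)"

definition jle :: "('a::euclidean_space \<Rightarrow> 'a \<Rightarrow> 'a) \<Rightarrow> 'a \<Rightarrow> 'a \<Rightarrow> bool" where
  "jle m x y \<longleftrightarrow> y - x \<in> cone m"

definition Mfun :: "('a::euclidean_space \<Rightarrow> 'a \<Rightarrow> 'a) \<Rightarrow> 'a \<Rightarrow> 'a \<Rightarrow> real" where
  "Mfun m x y = Inf {\<beta>. jle m x (\<beta> *\<^sub>R y)}"

definition thompson :: "('a::euclidean_space \<Rightarrow> 'a \<Rightarrow> 'a) \<Rightarrow> 'a \<Rightarrow> 'a \<Rightarrow> real" where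
  "thompson m x y = max (ln (Mfun m x y)) (ln (Mfun m y x))"

text \<open>h_w, restricted to the symmetric cone (elements of the product space R^{A_+^o})\<close>
definition hw :: "('a::euclidean_space \<Rightarrow> 'a \<Rightarrow> 'a) \<Rightarrow> 'a \<Rightarrow> 'a \<Rightarrow> ('a \<Rightarrow> real)" where
  "hw m u w = restrict (\<lambda>x. thompson m x w - thompson m u w) (icone m)"

definition pw_top :: "('a::euclidean_space \<Rightarrow> 'a \<Rightarrow> 'a) \<Rightarrow> ('a \<Rightarrow> real) topology" where
  "pw_top m = product_topology (\<lambda>_. euclideanreal) (icone m)"

definition horofunction :: "('a::euclidean_space \<Rightarrow> 'a \<Rightarrow> 'a) \<Rightarrow> 'a \<Rightarrow> ('a \<Rightarrow> real) \<Rightarrow> bool" where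
  "horofunction m u h \<longleftrightarrow>
     h \<in> pw_top m closure_of (hw m u ` icone m) \<and> h \<notin> hw m u ` icone m"

definition almost_geodesic :: "('a::euclidean_space \<Rightarrow> 'a \<Rightarrow> 'a) \<Rightarrow> real set \<Rightarrow> (real \<Rightarrow> 'a) \<Rightarrow> bool" where
  "almost_geodesic m T \<gamma> \<longleftrightarrow>
     T \<subseteq> {0..} \<and> 0 \<in> T \<and> (\<forall>B. \<exists>t\<in>T. t > B) \<and> \<gamma> ` T \<subseteq> icone m \<and>
     (\<forall>\<epsilon>>0. \<exists>N. \<forall>t\<in>T. \<forall>s\<in>T. N \<le> s \<and> s \<le> t \<longrightarrow>
        \<bar>thompson m (\<gamma> t) (\<gamma> s) + thompson m (\<gamma> s) (\<gamma> 0) - t\<bar> < \<epsilon>)"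

definition busemann :: "('a::euclidean_space \<Rightarrow> 'a \<Rightarrow> 'a) \<Rightarrow> 'a \<Rightarrow> ('a \<Rightarrow> real) \<Rightarrow> bool" where
  "busemann m u h \<longleftrightarrow> horofunction m u h \<and>
     (\<exists>T \<gamma>. almost_geodesic m T \<gamma> \<and>
        limitin (pw_top m) (\<lambda>t. hw m u (\<gamma> t)) h (inf at_top (principal T)))"

definition horo_form :: "('a::euclidean_space \<Rightarrow> 'a \<Rightarrow> 'a) \<Rightarrow> 'a \<Rightarrow> 'a \<Rightarrow> 'a \<Rightarrow> ('a \<Rightarrow> real)" where
  "horo_form m u y z = restrict (\<lambda>x.
      if y = 0 then ln (Mfun m z (jinv m u x))
      else if z = 0 then ln (Mfun m y x)
      else max (ln (Mfun m y x)) (ln (Mfun m z (jinv m u x)))) (icone m)"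

end

theory Submission
  imports Defs "HOL-Computational_Algebra.Fundamental_Theorem_Algebra"
begin

text \<open>
  Inversion reverses the order of the cone, so \<open>M(x/w) = M(w\<^sup>-\<^sup>1/x\<^sup>-\<^sup>1)\<close>, and \<open>h\<^sub>w\<close> is
  \<open>x \<mapsto> log max {M(y/x), M(z/x\<^sup>-\<^sup>1)}\<close> for \<open>y = e\<^sup>-\<^sup>r w\<close>, \<open>z = e\<^sup>-\<^sup>r w\<^sup>-\<^sup>1\<close>, \<open>r = d\<^sub>T(u, w)\<close>. Such pairs lie in the
  compact set of all \<open>(y, z)\<close> in the cone with \<open>max {M(y/u), M(z/u)} = 1\<close> and \<open>y \<odot> z = s u\<close>, \<open>0 \<le> s \<le> 1\<close>; its
  image is closed, pairs with \<open>s > 0\<close> give internal points and pairs with \<open>s = 0\<close> the claimed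
  functions. Conversely, \<open>y \<odot> z = 0\<close> forces a common spectral frame, in which an explicit geodesic
  converges to the function given by \<open>(y, z)\<close>, and this function tends to \<open>-\<infinity>\<close> along the geodesic.

  For order reversal, the automorphisms \<open>P(s c + (u - c))\<close> of the cone, with \<open>c\<close> idempotent and \<open>P\<close> the
  quadratic representation, suffice. They are explicit on the Peirce components of \<open>c\<close>, which avoids the
  fundamental formula.
\<close>

section \<open>Preliminaries\<close>

text \<open>The axioms supply neither associativity nor a spectral theorem, and the inner product of
  the type need not be compatible with \<open>\<odot>\<close>. Two descriptions of the cone make up
  for this: nonnegative coefficients in a frame, which settle what concerns a single element
  (inverse, norm, interior), and positive semidefiniteness of multiplication for the trace form,
  which is linear in the element and so handles sums and limits of elements without a common frame.
  For the horofunctions no sequence is extracted: the whole closure is trapped at once in the image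
  of the compact parameter set. The parameter of an internal point \<open>w\<close> is s = exp (-2
  d_T(u, w)), so s = 0 is what remains at infinity. A pair with s = 0 cannot give an internal
  function because h_w is bounded below by -d_T(u, w).\<close>

lemma real_poly_complex_root_dvd:
  fixes q :: "real poly"
  assumes "poly (map_poly complex_of_real q) (Complex a b) = 0" "b \<noteq> 0"
  shows "[:a\<^sup>2 + b\<^sup>2, - 2 * a, 1:] dvd q"
proof -
  define d where "d = [:a\<^sup>2 + b\<^sup>2, - 2 * a, 1:]"
  define r where "r = q mod d"
  have deg: "degree d = 2" by (simp add: d_def)
  have hom: "map_poly complex_of_real (p1 * p2 + p3)
    = map_poly complex_of_real p1 * map_poly complex_of_real p2 + map_poly complex_of_real p3" for p1 p2 p3
    by (intro poly_eqI) (simp add: coeff_map_poly coeff_mult)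
  have d0: "poly (map_poly complex_of_real d) (Complex a b) = 0"
    by (simp add: d_def map_poly_pCons complex_eq_iff power2_eq_square algebra_simps)
  have "q = (q div d) * d + r" by (simp add: r_def)
  then have "map_poly complex_of_real q = map_poly complex_of_real (q div d) * map_poly complex_of_real d
      + map_poly complex_of_real r" by (metis hom)
  then have "poly (map_poly complex_of_real r) (Complex a b) = 0" using assms(1) d0 by simp
  \<comment> \<open>The remainder is real and at most linear, so a nonreal root forces both of its
    coefficients to vanish.\<close>
  moreover have "r = [:coeff r 0, coeff r 1:]"
  proof (rule poly_eqI)
    fix i
    have "r = 0 \<or> degree r < 2" using deg degree_mod_less[of d q] unfolding r_def by force
    then have "coeff r i = 0" if "i \<ge> 2" using that by (auto intro: coeff_eq_0)
    then show "coeff r i = coeff [:coeff r 0, coeff r 1:] i"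
      by (auto simp: coeff_pCons split: nat.split)
  qed
  then have "map_poly complex_of_real r = [:of_real (coeff r 0), of_real (coeff r 1):]"
    by (metis map_poly_pCons map_poly_0 of_real_0)
  ultimately have "coeff r 1 = 0" "coeff r 0 = 0" using assms(2) by (auto simp: complex_eq_iff)
  then have "r = 0" using \<open>r = [:coeff r 0, coeff r 1:]\<close> by simp
  then show ?thesis unfolding r_def d_def by (simp add: mod_eq_0_iff_dvd)
qed

section \<open>Traces of operators and of projections\<close>

definition trace_op :: "('a::euclidean_space \<Rightarrow> 'a) \<Rightarrow> real" where
  "trace_op f = (\<Sum>b\<in>Basis. f b \<bullet> b)"

lemma trace_op_add: "trace_op (\<lambda>x. f x + g x) = trace_op f + trace_op g"
  and trace_op_diff: "trace_op (\<lambda>x. f x - g x) = trace_op f - trace_op g"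
  and trace_op_scale: "trace_op (\<lambda>x. a *\<^sub>R f x) = a * trace_op f"
  by (simp_all add: trace_op_def inner_add_left inner_diff_left sum.distrib sum_subtractf sum_distrib_left)

lemma trace_op_commute:
  fixes f g :: "'a::euclidean_space \<Rightarrow> 'a"
  assumes "linear f" "linear g"
  shows "trace_op (\<lambda>x. f (g x)) = trace_op (\<lambda>x. g (f x))"
proof -
  have *: "trace_op (\<lambda>x. f (g x)) = (\<Sum>b\<in>Basis. \<Sum>c\<in>Basis. (g b \<bullet> c) * (f c \<bullet> b))"
    if "linear f" for f g :: "'a \<Rightarrow> 'a"
    unfolding trace_op_def
  proof (rule sum.cong[OF refl])
    fix b :: 'a
    have "f (g b) = f (\<Sum>c\<in>Basis. (g b \<bullet> c) *\<^sub>R c)" by (simp add: euclidean_representation)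
    then show "f (g b) \<bullet> b = (\<Sum>c\<in>Basis. (g b \<bullet> c) * (f c \<bullet> b))"
      by (simp add: linear_sum[OF that] linear_scale[OF that] inner_sum_left)
  qed
  show ?thesis
    unfolding *[OF assms(1)] *[OF assms(2)] by (subst sum.swap) (simp add: mult.commute)
qed

text \<open>The trace of a projection \<open>P\<close> equals that of the orthogonal projection \<open>Q\<close> onto its range,
  because \<open>P Q = Q\<close> and \<open>Q P = P\<close>.\<close>

lemma trace_op_projection:
  fixes P :: "'a::euclidean_space \<Rightarrow> 'a"
  assumes "linear P" "\<And>x. P (P x) = P x"
  shows "0 \<le> trace_op P" "P c = c \<Longrightarrow> c \<noteq> 0 \<Longrightarrow> 0 < trace_op P"
proof -
  have sub: "subspace (range P)" using assms(1) by (intro linear_subspace_image) auto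
  obtain B where B: "B \<subseteq> range P" "pairwise orthogonal B" "\<And>x. x \<in> B \<Longrightarrow> norm x = 1"
    "independent B" "card B = dim (range P)" "span B = range P"
    using orthonormal_basis_subspace[OF sub] by metis
  have fin: "finite B" using B(4) by (rule independent_imp_finite)
  define Q where "Q x = (\<Sum>b\<in>B. (x \<bullet> b) *\<^sub>R b)" for x
  have linQ: "linear Q"
    by (rule linearI) (simp_all add: Q_def inner_add_left scaleR_add_left sum.distrib scaleR_sum_right)
  have QP: "Q (P x) = P x" for x
    unfolding Q_def by (rule orthonormal_basis_expand[OF B(2) B(3) _ fin]) (simp_all add: B(6))
  have "P b = b" if "b \<in> B" for b using that B(1) assms(2) by auto
  then have PQ: "P (Q x) = Q x" for x
    by (simp add: Q_def linear_sum[OF assms(1)] linear_scale[OF assms(1)])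
  have "trace_op P = trace_op (\<lambda>x. Q (P x))" by (simp add: QP)
  also have "\<dots> = trace_op (\<lambda>x. P (Q x))" by (rule trace_op_commute[OF linQ assms(1)])
  also have "\<dots> = (\<Sum>e\<in>Basis. \<Sum>b\<in>B. (b \<bullet> e) * (b \<bullet> e))"
    unfolding PQ by (simp add: trace_op_def Q_def inner_sum_left inner_sum_right inner_commute)
  also have "\<dots> = (\<Sum>b\<in>B. b \<bullet> b)"
    by (subst sum.swap) (simp add: euclidean_inner[symmetric])
  also have "\<dots> = real (card B)"
    using B(3) by (simp add: norm_eq_1)
  finally have tr: "trace_op P = real (card B)" .
  then show "0 \<le> trace_op P" by simp
  assume "P c = c" "c \<noteq> 0"
  then have "c \<in> span B" using B(6) by (metis rangeI)
  then have "B \<noteq> {}" using \<open>c \<noteq> 0\<close> by auto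
  then show "0 < trace_op P" using tr fin by (simp add: card_gt_0_iff)
qed

lemma ln_max: "0 < a \<Longrightarrow> 0 < b \<Longrightarrow> ln (max a b) = max (ln a) (ln (b::real))"
  by (simp add: max_def)

lemma tendsto_exp_neg: "((\<lambda>t::real. exp (- t)) \<longlongrightarrow> 0) at_top"
  by (rule filterlim_compose[OF exp_at_bot filterlim_uminus_at_bot_at_top])

text \<open>For a curve on a whole half-line, this turns the filter in \<open>busemann\<close> into
  the ordinary limit at infinity.\<close>

lemma inf_at_top_atLeast: "inf at_top (principal {a..}) = (at_top :: real filter)"
  by (intro inf_absorb1) (simp add: le_principal eventually_ge_at_top)

section \<open>The linearised Jordan identity\<close>

locale fr_jordan =
  fixes m :: "'a::euclidean_space \<Rightarrow> 'a \<Rightarrow> 'a" (infixl "\<odot>" 70) and u :: 'a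
  assumes frj: "formally_real_jordan (\<odot>) u"
begin

lemma bil: "bilinear (\<odot>)"
  and comm: "x \<odot> y = y \<odot> x"
  and jordan: "(x \<odot> x) \<odot> (x \<odot> y) = x \<odot> ((x \<odot> x) \<odot> y)"
  and formally_real: "x \<odot> x + y \<odot> y = 0 \<Longrightarrow> x = 0 \<and> y = 0"
  and unit_left [simp]: "u \<odot> x = x"
proof -
  note * = frj[unfolded formally_real_jordan_def]
  show "bilinear (\<odot>)" using * by (elim conjE)
  show "x \<odot> y = y \<odot> x" using * by (elim conjE) (erule allE, erule spec)
  show "(x \<odot> x) \<odot> (x \<odot> y) = x \<odot> ((x \<odot> x) \<odot> y)" using * by (elim conjE) metis
  show "x \<odot> x + y \<odot> y = 0 \<Longrightarrow> x = 0 \<and> y = 0" using * by (elim conjE) metis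
  show "u \<odot> x = x" using * by (elim conjE) metis
qed

lemma unit_right [simp]: "x \<odot> u = x"
  by (simp add: comm[of x u])

lemma linear_mult: "linear ((\<odot>) x)"
  using bil by (simp add: bilinear_def)

lemma mult_add_right: "x \<odot> (y + z) = x \<odot> y + x \<odot> z"
  and mult_add_left: "(x + y) \<odot> z = x \<odot> z + y \<odot> z"
  and mult_diff_right: "x \<odot> (y - z) = x \<odot> y - x \<odot> z"
  and mult_diff_left: "(x - y) \<odot> z = x \<odot> z - y \<odot> z"
  and mult_minus_right [simp]: "x \<odot> (- y) = - (x \<odot> y)"
  and mult_minus_left [simp]: "(- x) \<odot> y = - (x \<odot> y)"
  and mult_zero_right [simp]: "x \<odot> 0 = 0"
  and mult_zero_left [simp]: "0 \<odot> x = 0"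
  and mult_scale_right [simp]: "x \<odot> (a *\<^sub>R y) = a *\<^sub>R (x \<odot> y)"
  and mult_scale_left [simp]: "(a *\<^sub>R x) \<odot> y = a *\<^sub>R (x \<odot> y)"
  using bil by (simp_all add: bilinear_radd bilinear_ladd bilinear_rsub bilinear_lsub bilinear_rneg
      bilinear_lneg bilinear_rzero bilinear_lzero bilinear_rmul bilinear_lmul)

lemmas mult_distribs = mult_add_right mult_add_left mult_diff_right mult_diff_left

lemma mult_sum_right: "x \<odot> sum f A = (\<Sum>i\<in>A. x \<odot> f i)"
  using linear_sum[OF linear_mult] .

lemma mult_sum_left: "sum f A \<odot> x = (\<Sum>i\<in>A. f i \<odot> x)"
  by (simp add: comm[of _ x] mult_sum_right)

text \<open>The Jordan identity is cubic in its first variable. Inclusion-exclusion over the sums of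
  \<open>x\<close>, \<open>y\<close>, \<open>z\<close> extracts the trilinear part, in which each
  term occurs twice by commutativity.\<close>

lemma jordan_linearized:
  "(x \<odot> y) \<odot> (z \<odot> w) + (y \<odot> z) \<odot> (x \<odot> w) + (z \<odot> x) \<odot> (y \<odot> w)
   = z \<odot> ((x \<odot> y) \<odot> w) + x \<odot> ((y \<odot> z) \<odot> w) + y \<odot> ((z \<odot> x) \<odot> w)" (is "?l = ?r")
proof -
  define G where "G a = (a \<odot> a) \<odot> (a \<odot> w) - a \<odot> ((a \<odot> a) \<odot> w)" for a
  have G0: "G a = 0" for a by (simp add: G_def jordan)
  have "2 *\<^sub>R (?l - ?r) = G (x + y + z) - G (x + y) - G (y + z) - G (x + z) + G x + G y + G z"
    unfolding G_def mult_distribs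
    by (simp add: algebra_simps scaleR_2 comm[of y x] comm[of z x] comm[of z y])
  then show ?thesis by (simp add: G0)
qed

text \<open>Read as an operator applied to \<open>y\<close>, multiplication by a triple product is
  expressed through multiplications by the factors and by their pairwise products. Powers, the
  Peirce cubic and the associativity of \<open>tau\<close> all rest on this form.\<close>

lemma mult_triple:
  "((z \<odot> x) \<odot> w) \<odot> y = (z \<odot> w) \<odot> (x \<odot> y) + (x \<odot> w) \<odot> (z \<odot> y) + (z \<odot> x) \<odot> (w \<odot> y)
     - z \<odot> (w \<odot> (x \<odot> y)) - x \<odot> (w \<odot> (z \<odot> y))"
proof -
  have "((z \<odot> x) \<odot> w) \<odot> y = y \<odot> ((z \<odot> x) \<odot> w)" by (rule comm)
  also have "\<dots> = (x \<odot> y) \<odot> (z \<odot> w) + (y \<odot> z) \<odot> (x \<odot> w) + (z \<odot> x) \<odot> (y \<odot> w)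
      - z \<odot> ((x \<odot> y) \<odot> w) - x \<odot> ((y \<odot> z) \<odot> w)"
    using jordan_linearized[of x y z w] by (simp add: algebra_simps)
  finally show ?thesis
    by (simp only: comm[of "x \<odot> y" "z \<odot> w"] comm[of "y \<odot> z" "x \<odot> w"] comm[of y z] comm[of y w]
      comm[of "x \<odot> y" w] comm[of "z \<odot> y" w] comm[of "z \<odot> y" "x \<odot> w"])
qed

section \<open>Powers and the spectral theorem\<close>

text \<open>By \<open>mult_triple\<close>, multiplication by the power n + 2 is a polynomial in the
  multiplications by \<open>x\<close>, by its square and by the two preceding powers. These commute
  with multiplication by \<open>x\<close> by the Jordan identity and by induction, hence the
  two-step induction.\<close>

lemma mult_power_commute: "x \<odot> ((((\<odot>) x ^^ n) u) \<odot> y) = (((\<odot>) x ^^ n) u) \<odot> (x \<odot> y)"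
proof (induction n arbitrary: y rule: induct_nat_012)
  case 0 show ?case by simp
next
  case 1 show ?case by simp
next
  case (ge2 n)
  define w where "w = ((\<odot>) x ^^ n) u"
  have e: "((\<odot>) x ^^ Suc n) u = w \<odot> x" "((\<odot>) x ^^ Suc (Suc n)) u = (w \<odot> x) \<odot> x"
    by (simp_all add: w_def comm[of x])
  have c1: "x \<odot> (w \<odot> y) = w \<odot> (x \<odot> y)" for y using ge2(1) by (simp add: w_def)
  have c2: "x \<odot> ((w \<odot> x) \<odot> y) = (w \<odot> x) \<odot> (x \<odot> y)" for y using ge2(2) by (simp only: e)
  show ?case
    unfolding e mult_triple[of w x x] mult_distribs c1 c2 by (simp add: jordan[symmetric] c1)
qed

text \<open>Horner evaluation at \<open>x\<close>. It fixes one bracketing of the powers, so it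
  makes sense before power associativity is known; the latter is the content of
  \<open>ev_mult\<close>.\<close>

definition ev :: "'a \<Rightarrow> real poly \<Rightarrow> 'a" where
  "ev x p = fold_coeffs (\<lambda>a v. a *\<^sub>R u + x \<odot> v) p 0"

lemma ev_0 [simp]: "ev x 0 = 0"
  by (simp add: ev_def)

lemma ev_pCons [simp]: "ev x (pCons a p) = a *\<^sub>R u + x \<odot> ev x p"
  by (cases "p = 0 \<and> a = 0") (auto simp: ev_def)

lemma ev_1 [simp]: "ev x 1 = u"
  by (simp add: one_pCons)

lemma ev_add [simp]: "ev x (p + q) = ev x p + ev x q"
  by (induction p q rule: poly_induct2) (simp_all add: algebra_simps mult_distribs)

lemma ev_smult [simp]: "ev x (smult a p) = a *\<^sub>R ev x p"
  by (induction p) (simp_all add: algebra_simps)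

lemma ev_sum: "ev x (sum f A) = (\<Sum>i\<in>A. ev x (f i))"
  by (induction A rule: infinite_finite_induct) simp_all

lemma ev_minus [simp]: "ev x (- p) = - ev x p"
  using ev_smult[of x "-1" p] by simp

lemma ev_diff [simp]: "ev x (p - q) = ev x p - ev x q"
  using ev_add[of x p "- q"] by simp

lemma ev_span: "\<exists>f N. ev x p = (\<Sum>i<N. f i *\<^sub>R ((\<odot>) x ^^ i) u)"
proof (induction p)
  case 0 show ?case by (rule exI[of _ "\<lambda>_. 0"]) simp
next
  case (pCons a p)
  then obtain f N where "ev x p = (\<Sum>i<N. f i *\<^sub>R ((\<odot>) x ^^ i) u)" by auto
  then have "ev x (pCons a p) = (\<Sum>i<Suc N. (case i of 0 \<Rightarrow> a | Suc j \<Rightarrow> f j) *\<^sub>R ((\<odot>) x ^^ i) u)"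
    by (subst sum.lessThan_Suc_shift) (simp add: mult_sum_right)
  then show ?case by metis
qed

lemma mult_ev_commute: "x \<odot> (ev x p \<odot> y) = ev x p \<odot> (x \<odot> y)"
proof -
  obtain f N where *: "ev x p = (\<Sum>i<N. f i *\<^sub>R ((\<odot>) x ^^ i) u)" using ev_span by blast
  show ?thesis unfolding * by (simp add: mult_sum_left mult_sum_right mult_power_commute)
qed

lemma ev_mult [simp]: "ev x (p * q) = ev x p \<odot> ev x q"
proof (induction p)
  case (pCons a p)
  have "ev x (pCons a p) \<odot> ev x q = a *\<^sub>R ev x q + ev x q \<odot> (x \<odot> ev x p)"
    by (simp add: mult_distribs comm[of _ "ev x q"])
  also have "ev x q \<odot> (x \<odot> ev x p) = x \<odot> (ev x p \<odot> ev x q)"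
    using mult_ev_commute[of x q "ev x p"] by (simp add: comm[of "ev x q" "ev x p"])
  finally show ?case using pCons by simp
qed simp

lemma square_eq_0: "x \<odot> x = 0 \<Longrightarrow> x = 0"
  using formally_real[of x 0] by simp

text \<open>Formal reality excludes nilpotents, so whatever annihilates \<open>x\<close> after
  squaring annihilates it already. This rules out multiple roots below.\<close>

lemma ev_square_dvd_eq_0:
  assumes "ev x p = 0" "p dvd q * q"
  shows "ev x q = 0"
proof -
  obtain r where "q * q = p * r" using assms(2) by (rule dvdE)
  then have "ev x q \<odot> ev x q = ev x p \<odot> ev x r" by (metis ev_mult)
  then show ?thesis using assms(1) by (metis mult_zero_left square_eq_0)
qed

lemma u_nonzero: "u \<noteq> 0"
proof
  assume "u = 0"
  then have "x = 0" for x :: 'a using unit_left[of x] mult_zero_left[of x] by metis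
  moreover obtain b :: 'a where "b \<in> Basis" using nonempty_Basis by blast
  ultimately show False using nonzero_Basis by blast
qed

lemma exists_annihilating_poly: "\<exists>p. p \<noteq> 0 \<and> ev x p = 0"
proof (rule ccontr)
  assume no: "\<not> ?thesis"
  define n where "n = DIM('a)"
  define f where "f k = ev x (monom 1 k)" for k
  have inj: "inj f"
  proof (rule injI)
    fix i j assume "f i = f j"
    then have "ev x (monom 1 i - monom 1 j) = 0" by (simp add: f_def)
    then have "monom (1::real) i = monom 1 j" using no by (metis eq_iff_diff_eq_0)
    then have "coeff (monom (1::real) i) i = coeff (monom 1 j) i" by simp
    then show "i = j" by (simp split: if_splits)
  qed
  have "independent (f ` {..n})"
    unfolding independent_explicit_finite_subsets
  proof (intro allI impI ballI)
    fix A c v assume A: "A \<subseteq> f ` {..n}" "finite A" and s: "(\<Sum>v\<in>A. c v *\<^sub>R v) = 0" and v: "v \<in> A"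
    obtain I where I: "A = f ` I" using A(1) by (metis subset_image_iff)
    have fI: "finite I" using A(2) I inj by (simp add: finite_image_iff inj_on_subset)
    define p where "p = (\<Sum>i\<in>I. smult (c (f i)) (monom 1 i))"
    have "(\<Sum>v\<in>A. c v *\<^sub>R v) = (\<Sum>i\<in>I. c (f i) *\<^sub>R f i)"
      unfolding I by (subst sum.reindex) (auto intro: inj_on_subset[OF inj])
    then have "ev x p = 0" using s by (simp add: p_def ev_sum f_def)
    then have "p = 0" using no by blast
    moreover have "coeff p i = (\<Sum>j\<in>I. if j = i then c (f j) else 0)" for i
      unfolding p_def coeff_sum by (intro sum.cong) auto
    then have "coeff p i = c (f i)" if "i \<in> I" for i
      using that fI by simp
    ultimately show "c v = 0" using v I by auto
  qed
  then have "card (f ` {..n}) \<le> DIM('a)" using independent_bound by blast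
  then show False using inj by (simp add: card_image inj_on_subset n_def)
qed

text \<open>Take an annihilating polynomial of least degree. A factor (X - a)^2 + b^2 with cofactor
  v makes the squares of the values at \<open>x\<close> of (X - a) v and b v sum to zero, so v
  annihilates \<open>x\<close>. A double root a with cofactor v makes the value of (X - a) v square
  to zero. Both contradict minimality, so all roots are real and simple.\<close>

lemma exists_split_annihilating_poly:
  "\<exists>S::real set. finite S \<and> ev x (\<Prod>s\<in>S. [:- s, 1:]) = 0"
proof -
  define P where "P p \<longleftrightarrow> p \<noteq> 0 \<and> ev x p = 0" for p
  obtain p where p: "P p" and min: "\<And>q. P q \<Longrightarrow> degree p \<le> degree q"
    using exists_annihilating_poly[of x] ex_has_least_nat[of P _ degree] unfolding P_def by metis
  have p0: "p \<noteq> 0" "ev x p = 0" using p by (auto simp: P_def)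
  have small: "ev x q \<noteq> 0" if "q dvd p" "degree q < degree p" for q
    using that min[of q] p0 by (auto simp: P_def)
  \<comment> \<open>Stated for all divisors of \<open>p\<close>: the induction strips one root at a
    time, while minimality still refers to the full \<open>p\<close>.\<close>
  have split: "\<exists>S c. finite S \<and> q = smult c (\<Prod>s\<in>S. [:- s, 1:])" if "q dvd p" for q
    using that
  proof (induction "degree q" arbitrary: q rule: less_induct)
    case less
    have q0: "q \<noteq> 0" using less p0 by auto
    show ?case
    proof (cases "degree q = 0")
      case True
      then obtain c where "q = [:c:]" by (metis degree_eq_zeroE)
      then show ?thesis by (intro exI[of _ "{}"] exI[of _ c]) simp
    next
      case False
      then have "\<not> constant (poly (map_poly complex_of_real q))"
        by (simp add: constant_degree degree_map_poly)
      then obtain z where z: "poly (map_poly complex_of_real q) z = 0"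
        using fundamental_theorem_of_algebra by blast
      obtain a b where ab: "z = Complex a b" by (cases z)
      show ?thesis
      proof (cases "b = 0")
        case False
        have "[:a\<^sup>2 + b\<^sup>2, - 2 * a, 1:] dvd p"
          using real_poly_complex_root_dvd[of q a b] z ab False less(2) dvd_trans by blast
        then obtain v where v: "p = [:a\<^sup>2 + b\<^sup>2, - 2 * a, 1:] * v" by (rule dvdE)
        define e where "e = ev x v"
        define f where "f = ev x ([:- a, 1:] * v)"
        have "f \<odot> f + (b *\<^sub>R e) \<odot> (b *\<^sub>R e) = ev x (([:- a, 1:] * v) * ([:- a, 1:] * v) + smult b v * smult b v)"
          unfolding e_def f_def by (simp only: ev_mult ev_add ev_smult)
        also have "([:- a, 1:] * v) * ([:- a, 1:] * v) + smult b v * smult b v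
           = ([:- a, 1:] * v) * ([:- a, 1:] * v) + ([:b:] * v) * ([:b:] * v)" by simp
        also have "\<dots> = ([:- a, 1:] * [:- a, 1:] + [:b:] * [:b:]) * (v * v)"
          by (simp only: distrib_right mult.assoc mult.left_commute[of v])
        also have "[:- a, 1:] * [:- a, 1:] + [:b:] * [:b:] = [:a\<^sup>2 + b\<^sup>2, - 2 * a, 1:]"
          by (simp add: power2_eq_square)
        also have "[:a\<^sup>2 + b\<^sup>2, - 2 * a, 1:] * (v * v) = p * v" by (simp only: v mult.assoc)
        also have "ev x (p * v) = 0" by (simp add: p0)
        finally have "b *\<^sub>R e = 0" using formally_real by blast
        then have "e = 0" using False by simp
        moreover have "v \<noteq> 0" using p0 v by auto
        then have "degree v < degree p" unfolding v by (subst degree_mult_eq) auto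
        moreover have "v dvd p" by (simp only: v dvd_triv_right)
        ultimately show ?thesis using small[of v] by (simp add: e_def)
      next
        case True
        have "poly (map_poly complex_of_real q) (of_real a) = of_real (poly q a)"
          by (simp add: poly_altdef degree_map_poly coeff_map_poly)
        then have "poly q a = 0" using z ab True by (simp add: complex_of_real_def complex_eq_iff)
        then obtain q' where q': "q = [:- a, 1:] * q'" by (metis poly_eq_0_iff_dvd dvdE)
        have q'0: "q' \<noteq> 0" using q' q0 by auto
        have "degree q = Suc (degree q')" unfolding q' using q'0 by (subst degree_mult_eq) auto
        moreover have "q' dvd p" using less(2) q' dvd_trans by (metis dvd_triv_right)
        ultimately obtain S c where S: "finite S" "q' = smult c (\<Prod>s\<in>S. [:- s, 1:])"
          using less(1)[of q'] by auto
        have "a \<notin> S"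
        proof
          assume "a \<in> S"
          then have "[:- a, 1:] dvd q'" using S by (metis dvd_prodI dvd_smult)
          then have "[:- a, 1:] * [:- a, 1:] dvd p"
            using q' less(2) by (meson dvd_refl dvd_trans mult_dvd_mono)
          then obtain v where v: "p = [:- a, 1:] * [:- a, 1:] * v" by (rule dvdE)
          then have "p dvd ([:- a, 1:] * v) * ([:- a, 1:] * v)"
            by (intro dvdI[of _ _ v]) (simp only: ac_simps)
          then have "ev x ([:- a, 1:] * v) = 0" using ev_square_dvd_eq_0 p0 by blast
          moreover have "v \<noteq> 0" using p0 v by auto
          then have "degree p = Suc (degree ([:- a, 1:] * v))"
            unfolding v mult.assoc by (subst degree_mult_eq) (auto simp del: mult_pCons_left)
          ultimately show False using small[of "[:- a, 1:] * v"] v by (metis dvd_triv_right lessI mult.assoc)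
        qed
        then have "q = smult c (\<Prod>s\<in>insert a S. [:- s, 1:])"
          using S q' by (simp add: mult.commute)
        then show ?thesis using S(1) by blast
      qed
    qed
  qed
  obtain S c where S: "finite S" "p = smult c (\<Prod>s\<in>S. [:- s, 1:])" using split[OF dvd_refl] by blast
  then have "c \<noteq> 0" using p0 by auto
  then show ?thesis using S p0 by auto
qed

definition frame :: "'a set \<Rightarrow> bool" where
  "frame P \<longleftrightarrow> finite P \<and> 0 \<notin> P \<and> (\<forall>p\<in>P. p \<odot> p = p) \<and>
     (\<forall>p\<in>P. \<forall>q\<in>P. p \<noteq> q \<longrightarrow> p \<odot> q = 0) \<and> \<Sum>P = u"

text \<open>The idempotents are the values at \<open>x\<close> of the Lagrange interpolation
  polynomials on the roots. Products of two of them vanish modulo \<open>n\<close>, their sum is 1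
  because it has degree below \<open>card S\<close> and takes the value 1 on \<open>S\<close>, and
  idempotency follows by multiplying this sum with one of its terms.\<close>

theorem spectral_decomposition: "\<exists>P f. frame P \<and> x = (\<Sum>p\<in>P. f p *\<^sub>R p)"
proof -
  obtain S :: "real set" where S: "finite S" "ev x (\<Prod>s\<in>S. [:- s, 1:]) = 0"
    using exists_split_annihilating_poly by blast
  define n where "n = (\<Prod>s\<in>S. [:- s, 1:])"
  have n0: "ev x n = 0" using S by (simp add: n_def)
  have ev0: "ev x p = 0" if "n dvd p" for p using that n0 by (elim dvdE) simp
  define k where "k s = (\<Prod>t\<in>S - {s}. [:- t, 1:])" for s
  have nk: "n = [:- s, 1:] * k s" if "s \<in> S" for s
    unfolding n_def k_def using S(1) that by (rule prod.remove)
  define c where "c s = inverse (\<Prod>t\<in>S - {s}. s - t)" for s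
  define e where "e s = ev x (smult (c s) (k s))" for s
  have orth: "e s \<odot> e t = 0" if "s \<in> S" "t \<in> S" "s \<noteq> t" for s t
  proof -
    have "[:- s, 1:] dvd k t" unfolding k_def using that S(1) by (intro dvd_prodI) auto
    then have "n dvd k s * k t" unfolding nk[OF that(1)] mult.commute[of "k s"]
      by (intro mult_dvd_mono) auto
    then have "n dvd smult (c s) (k s) * smult (c t) (k t)" by (simp add: dvd_smult)
    then show ?thesis unfolding e_def ev_mult[symmetric] by (rule ev0)
  qed
  have eig: "x \<odot> e s = s *\<^sub>R e s" if "s \<in> S" for s
  proof -
    have "ev x ([:- s, 1:] * smult (c s) (k s)) = 0"
      using nk[OF that] by (intro ev0) (metis dvd_refl dvd_smult mult_smult_right)
    then have "ev x [:- s, 1:] \<odot> e s = 0" unfolding e_def ev_mult .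
    then show ?thesis by (simp add: mult_distribs)
  qed
  have "card S > 0"
    using S u_nonzero by (auto simp: card_gt_0_iff)
  have "(\<Sum>s\<in>S. smult (c s) (k s)) = 1"
  proof (rule poly_eqI_degree)
    fix r assume r: "r \<in> S"
    have "poly (k s) r = 0" if "s \<noteq> r" for s
      using r S(1) that by (auto simp: k_def poly_prod prod_zero_iff)
    then have "poly (\<Sum>s\<in>S. smult (c s) (k s)) r = (\<Sum>s\<in>S. if s = r then c r * poly (k r) r else 0)"
      unfolding poly_sum by (intro sum.cong) auto
    also have "\<dots> = c r * (\<Prod>t\<in>S - {r}. r - t)" using S(1) r by (simp add: k_def poly_prod)
    also have "\<dots> = 1" unfolding c_def using S(1) by (intro left_inverse) (auto simp: prod_zero_iff)
    finally show "poly (\<Sum>s\<in>S. smult (c s) (k s)) r = poly 1 r" by simp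
  next
    have "degree (k s) \<le> card (S - {s})" for s
      unfolding k_def using degree_prod_sum_le[of "S - {s}" "\<lambda>t. [:- t, 1:]"] S(1) by simp
    then have "degree (smult (c s) (k s)) \<le> card S - 1" if "s \<in> S" for s
      using that S(1) by (metis card_Diff_singleton degree_smult_le order_trans)
    then have "degree (\<Sum>s\<in>S. smult (c s) (k s)) \<le> card S - 1"
      using S(1) by (intro degree_sum_le) auto
    then show "degree (\<Sum>s\<in>S. smult (c s) (k s)) < card S" using \<open>card S > 0\<close> by linarith
  qed (use \<open>card S > 0\<close> in simp)
  then have "ev x (\<Sum>s\<in>S. smult (c s) (k s)) = u" by simp
  then have sum1: "(\<Sum>s\<in>S. e s) = u" by (simp only: ev_sum e_def)
  have idem: "e s \<odot> e s = e s" if "s \<in> S" for s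
  proof -
    have "e s = (\<Sum>t\<in>S. e s \<odot> e t)" by (simp flip: mult_sum_right add: sum1)
    also have "\<dots> = (\<Sum>t\<in>S. if t = s then e s \<odot> e s else 0)" using orth that by (intro sum.cong) auto
    finally show ?thesis using S(1) that by simp
  qed
  \<comment> \<open>The annihilating polynomial was not asserted to be minimal, so some of the
    idempotents may vanish. A frame excludes 0.\<close>
  define S' where "S' = {s\<in>S. e s \<noteq> 0}"
  have inj: "inj_on e S'"
  proof (rule inj_onI, rule ccontr)
    fix s t assume "s \<in> S'" "t \<in> S'" "e s = e t" "s \<noteq> t"
    then show False using orth[of s t] idem[of s] by (auto simp: S'_def)
  qed
  have "\<Sum>(e ` S') = (\<Sum>s\<in>S'. e s)" using inj by (simp add: sum.reindex)
  also have "\<dots> = u" unfolding sum1[symmetric] S'_def using S(1) by (intro sum.mono_neutral_left) auto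
  finally have "frame (e ` S')" unfolding frame_def
    using S(1) idem orth by (auto simp: S'_def)
  moreover have "x = (\<Sum>s\<in>S. x \<odot> e s)" by (simp flip: mult_sum_right add: sum1)
  then have "x = (\<Sum>s\<in>S. s *\<^sub>R e s)" using eig by simp
  then have "x = (\<Sum>s\<in>S'. s *\<^sub>R e s)" unfolding S'_def using S(1) by (subst sum.mono_neutral_left[of S]) auto
  then have "x = (\<Sum>p\<in>e ` S'. the_inv_into S' e p *\<^sub>R p)"
    using inj by (simp add: sum.reindex the_inv_into_f_f)
  ultimately show ?thesis by blast
qed

section \<open>Peirce decomposition and trace form\<close>

text \<open>The Peirce projections are the Lagrange polynomials for the nodes 1, 1/2 and 0 in the
  operator of multiplication by \<open>c\<close>. They are projections once that operator is
  annihilated by the cubic with these roots.\<close>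

definition peirce1 :: "'a \<Rightarrow> 'a \<Rightarrow> 'a" where
  "peirce1 c x = 2 *\<^sub>R (c \<odot> (c \<odot> x)) - c \<odot> x"

definition peirceh :: "'a \<Rightarrow> 'a \<Rightarrow> 'a" where
  "peirceh c x = 4 *\<^sub>R (c \<odot> x) - 4 *\<^sub>R (c \<odot> (c \<odot> x))"

definition peirce0 :: "'a \<Rightarrow> 'a \<Rightarrow> 'a" where
  "peirce0 c x = x - 3 *\<^sub>R (c \<odot> x) + 2 *\<^sub>R (c \<odot> (c \<odot> x))"

lemma peirce_sum: "peirce1 c x + peirceh c x + peirce0 c x = x"
  unfolding peirce1_def peirceh_def peirce0_def
  by (rule euclidean_eqI) (simp add: inner_add_left inner_diff_left)

lemma mult_eq_peirce: "c \<odot> x = peirce1 c x + (1/2) *\<^sub>R peirceh c x"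
  unfolding peirce1_def peirceh_def
  by (rule euclidean_eqI) (simp add: inner_add_left inner_diff_left field_simps)

lemma linear_peirce: "linear (peirce1 c)" "linear (peirceh c)" "linear (peirce0 c)"
  unfolding peirce1_def peirceh_def peirce0_def
  by (auto intro!: linearI simp: mult_distribs algebra_simps)

context
  fixes c assumes idem: "c \<odot> c = c"
begin

text \<open>\<open>mult_triple\<close> with all three factors equal to \<open>c\<close> says that t
  (t - 1/2) (t - 1) annihilates multiplication by \<open>c\<close>.\<close>

lemma idempotent_cubic: "c \<odot> (c \<odot> (c \<odot> x)) = (3/2) *\<^sub>R (c \<odot> (c \<odot> x)) - (1/2) *\<^sub>R (c \<odot> x)"
proof -
  have "c \<odot> x = (c \<odot> (c \<odot> x) + c \<odot> (c \<odot> x) + c \<odot> (c \<odot> x))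
     - c \<odot> (c \<odot> (c \<odot> x)) - c \<odot> (c \<odot> (c \<odot> x))"
    using mult_triple[of c c c x] unfolding idem by simp
  then have "(c \<odot> x) \<bullet> b = ((c \<odot> (c \<odot> x) + c \<odot> (c \<odot> x) + c \<odot> (c \<odot> x))
     - c \<odot> (c \<odot> (c \<odot> x)) - c \<odot> (c \<odot> (c \<odot> x))) \<bullet> b" for b by (rule arg_cong)
  note * = this[unfolded inner_add_left inner_diff_left]
  show ?thesis
  proof (rule euclidean_eqI)
    fix b :: 'a
    show "(c \<odot> (c \<odot> (c \<odot> x))) \<bullet> b = ((3/2) *\<^sub>R (c \<odot> (c \<odot> x)) - (1/2) *\<^sub>R (c \<odot> x)) \<bullet> b"
      using *[of b] unfolding inner_diff_left inner_scaleR_left by linarith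
  qed
qed

lemma peirce_eigen:
  "c \<odot> peirce1 c x = peirce1 c x" "c \<odot> peirceh c x = (1/2) *\<^sub>R peirceh c x" "c \<odot> peirce0 c x = 0"
  unfolding peirce1_def peirceh_def peirce0_def mult_distribs mult_scale_right idempotent_cubic
  by (rule euclidean_eqI, simp add: inner_add_left inner_diff_left algebra_simps)+

lemma peirce_of_eigen:
  "c \<odot> x = x \<Longrightarrow> peirce1 c x = x" "c \<odot> x = x \<Longrightarrow> peirceh c x = 0" "c \<odot> x = x \<Longrightarrow> peirce0 c x = 0"
  "c \<odot> x = (1/2) *\<^sub>R x \<Longrightarrow> peirce1 c x = 0" "c \<odot> x = (1/2) *\<^sub>R x \<Longrightarrow> peirceh c x = x"
  "c \<odot> x = (1/2) *\<^sub>R x \<Longrightarrow> peirce0 c x = 0"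
  "c \<odot> x = 0 \<Longrightarrow> peirce1 c x = 0" "c \<odot> x = 0 \<Longrightarrow> peirceh c x = 0" "c \<odot> x = 0 \<Longrightarrow> peirce0 c x = x"
  unfolding peirce1_def peirceh_def peirce0_def
  by (rule euclidean_eqI, simp add: inner_add_left inner_diff_left algebra_simps)+

text \<open>The linearised identity leaves 2a - 1 times the commutator of the multiplications by
  \<open>c\<close> and \<open>x\<close>, which is why the eigenvalue 1/2 is excluded.\<close>

lemma eigen_commute:
  assumes "c \<odot> x = a *\<^sub>R x" "a \<noteq> 1/2"
  shows "c \<odot> (x \<odot> y) = x \<odot> (c \<odot> y)"
proof -
  have "(a + a - 1) *\<^sub>R (x \<odot> (c \<odot> y) - c \<odot> (x \<odot> y)) = 0"
    using jordan_linearized[of c x c y]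
    unfolding idem comm[of x c] assms(1) scaleR_diff_left scaleR_diff_right scaleR_add_left
    by (simp add: algebra_simps)
  then show ?thesis using assms(2) by simp
qed

lemma eigen1_mult: "c \<odot> x = x \<Longrightarrow> c \<odot> y = a *\<^sub>R y \<Longrightarrow> c \<odot> (x \<odot> y) = a *\<^sub>R (x \<odot> y)"
  using eigen_commute[of x 1 y] by simp

lemma eigen0_mult: "c \<odot> x = 0 \<Longrightarrow> c \<odot> y = a *\<^sub>R y \<Longrightarrow> c \<odot> (x \<odot> y) = a *\<^sub>R (x \<odot> y)"
  using eigen_commute[of x 0 y] by simp

lemma eigen_1_0_mult: "c \<odot> x = x \<Longrightarrow> c \<odot> y = 0 \<Longrightarrow> x \<odot> y = 0"
  using eigen1_mult[of x y 0] eigen0_mult[of y x 1] by (simp add: comm[of y x])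

text \<open>The conclusion expresses that the product of two half-eigenvectors has no half
  component: \<open>peirceh c v\<close> is four times the difference of \<open>c \<odot> v\<close>
  and \<open>c \<odot> (c \<odot> v)\<close>.\<close>

lemma eigen_half_mult:
  assumes "c \<odot> x = (1/2) *\<^sub>R x" "c \<odot> y = (1/2) *\<^sub>R y"
  shows "c \<odot> (c \<odot> (x \<odot> y)) = c \<odot> (x \<odot> y)"
  using jordan_linearized[of x y c c] assms unfolding idem
  by (simp add: comm[of _ c] comm[of y x] flip: scaleR_add_left)

end

text \<open>The element \<open>s c + (u - c)\<close> has the value s on \<open>c\<close> and 1 on
  \<open>u - c\<close>. Its quadratic representation acts on the Peirce components by the pairwise
  products s^2, s and 1 of these values.\<close>

definition twist :: "'a \<Rightarrow> real \<Rightarrow> 'a \<Rightarrow> 'a" where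
  "twist c s x = s\<^sup>2 *\<^sub>R peirce1 c x + s *\<^sub>R peirceh c x + peirce0 c x"

lemma linear_twist: "linear (twist c s)"
  unfolding twist_def using linear_peirce[of c]
  by (auto intro!: linear_compose_add linear_compose_scale_right)

lemma twist_1 [simp]: "twist c 1 x = x"
  by (simp add: twist_def peirce_sum)

lemma twist_twist: "c \<odot> c = c \<Longrightarrow> twist c s (twist c t x) = twist c (s * t) x"
  unfolding twist_def
  by (simp add: linear_add linear_scale linear_peirce peirce_of_eigen peirce_eigen power_mult_distrib)

lemma twist_eigen:
  assumes "c \<odot> c = c"
  shows "twist c s c = s\<^sup>2 *\<^sub>R c" "c \<odot> x = 0 \<Longrightarrow> twist c s x = x"
  unfolding twist_def using assms by (simp_all add: peirce_of_eigen)

text \<open>In the twisted product the mixed terms collect to s (p + r) and (1/s) (q + t), while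
  \<open>W\<close> keeps weight 1. Both sums vanish: as \<open>u\<close> has no half component,
  \<open>x \<odot> y = u\<close> gives p + q + r + t = 0, and the commutation of \<open>x\<close>
  and \<open>y\<close>, tested on \<open>c\<close>, gives p + r = q + t.\<close>

lemma twist_mult_inverse:
  assumes c: "c \<odot> c = c" and xy: "x \<odot> y = u" and com: "x \<odot> (y \<odot> c) = y \<odot> (x \<odot> c)" and s: "s \<noteq> 0"
  shows "twist c s x \<odot> twist c (1/s) y = u"
proof -
  define x1 xh x0 y1 yh y0 where defs: "x1 = peirce1 c x" "xh = peirceh c x" "x0 = peirce0 c x"
    "y1 = peirce1 c y" "yh = peirceh c y" "y0 = peirce0 c y"
  have e: "c \<odot> x1 = x1" "c \<odot> xh = (1/2) *\<^sub>R xh" "c \<odot> x0 = 0"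
    "c \<odot> y1 = y1" "c \<odot> yh = (1/2) *\<^sub>R yh" "c \<odot> y0 = 0"
    unfolding defs by (simp_all add: peirce_eigen[OF c])
  have x: "x = x1 + xh + x0" and y: "y = y1 + yh + y0"
    by (simp_all add: defs peirce_sum)
  define W p q r t where W: "W = x1 \<odot> y1 + xh \<odot> yh + x0 \<odot> y0"
    and pqrt: "p = x1 \<odot> yh" "q = xh \<odot> y1" "r = xh \<odot> y0" "t = x0 \<odot> yh"
  have z: "x1 \<odot> y0 = 0" "x0 \<odot> y1 = 0"
    using eigen_1_0_mult[OF c] e comm[of x0 y1] by auto
  have "c \<odot> p = (1/2) *\<^sub>R p" "c \<odot> q = (1/2) *\<^sub>R q" "c \<odot> r = (1/2) *\<^sub>R r" "c \<odot> t = (1/2) *\<^sub>R t"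
    unfolding pqrt comm[of xh y1] comm[of xh y0]
    using eigen1_mult[OF c] eigen0_mult[OF c] e by auto
  then have half: "c \<odot> (p + q + r + t) = (1/2) *\<^sub>R (p + q + r + t)" by (simp add: mult_distribs algebra_simps)
  have "c \<odot> (x1 \<odot> y1) = x1 \<odot> y1" using eigen1_mult[OF c, of x1 y1 1] e by simp
  moreover have "c \<odot> (x0 \<odot> y0) = 0" using eigen0_mult[OF c, of x0 y0 0] e by simp
  ultimately have WW: "c \<odot> (c \<odot> W) = c \<odot> W"
    unfolding W mult_distribs using eigen_half_mult[OF c e(2,5)] by simp
  have sum: "x \<odot> y = W + (p + q + r + t)"
    unfolding x y W pqrt mult_distribs z by simp
  have "c \<odot> (c \<odot> (x \<odot> y)) = c \<odot> (x \<odot> y)" by (simp add: xy c)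
  moreover have "c \<odot> (x \<odot> y) = c \<odot> W + (1/2) *\<^sub>R (p + q + r + t)"
    unfolding sum mult_add_right[of c W] half ..
  moreover have "c \<odot> (c \<odot> W + (1/2) *\<^sub>R (p + q + r + t)) = c \<odot> W + (1/4) *\<^sub>R (p + q + r + t)"
    unfolding mult_add_right[of c "c \<odot> W"] WW mult_scale_right half by simp
  ultimately have "(1/4) *\<^sub>R (p + q + r + t) = (1/2) *\<^sub>R (p + q + r + t)"
    by (metis add_left_cancel)
  then have "((1/4) - (1/2)) *\<^sub>R (p + q + r + t) = 0" unfolding scaleR_diff_left by simp
  then have s1: "p + q + r + t = 0" by simp
  have xc: "x \<odot> c = x1 + (1/2) *\<^sub>R xh" and yc: "y \<odot> c = y1 + (1/2) *\<^sub>R yh"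
    unfolding x y comm[of _ c] mult_distribs by (simp_all add: e)
  have "x \<odot> (y \<odot> c) = x1 \<odot> y1 + (1/2) *\<^sub>R p + q + (1/2) *\<^sub>R (xh \<odot> yh) + (1/2) *\<^sub>R t"
    unfolding yc x mult_distribs by (simp add: pqrt z)
  moreover have "y \<odot> (x \<odot> c) = x1 \<odot> y1 + p + (1/2) *\<^sub>R q + (1/2) *\<^sub>R (xh \<odot> yh) + (1/2) *\<^sub>R r"
    unfolding xc y mult_distribs mult_scale_right comm[of y1 x1] comm[of yh x1] comm[of y0 x1]
      comm[of y1 xh] comm[of yh xh] comm[of y0 xh] by (simp add: pqrt z algebra_simps)
  ultimately have "(1/2) *\<^sub>R p + q + (1/2) *\<^sub>R t = p + (1/2) *\<^sub>R q + (1/2) *\<^sub>R r"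
    using com by (simp add: algebra_simps)
  then have "2 *\<^sub>R ((1/2) *\<^sub>R p + q + (1/2) *\<^sub>R t) = 2 *\<^sub>R (p + (1/2) *\<^sub>R q + (1/2) *\<^sub>R r)" by simp
  then have "p + 2 *\<^sub>R q + t = 2 *\<^sub>R p + q + r" by (simp add: scaleR_add_right)
  then have "q + t = p + r" by (simp add: scaleR_2 algebra_simps)
  moreover from s1 have "(p + r) + (q + t) = 0" by (simp add: algebra_simps)
  ultimately have "2 *\<^sub>R (p + r) = 0" "2 *\<^sub>R (q + t) = 0" by (simp_all add: scaleR_2)
  then have pr: "p + r = 0" and qt: "q + t = 0" by simp_all
  have "W = u" using sum xy s1 by simp
  have "twist c s x \<odot> twist c (1/s) y = W + s *\<^sub>R (p + r) + (1/s) *\<^sub>R (q + t)"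
    unfolding twist_def defs[symmetric] mult_distribs mult_scale_left mult_scale_right W pqrt z
    using s by (simp add: power2_eq_square algebra_simps)
  then show ?thesis using pr qt \<open>W = u\<close> by simp
qed

text \<open>The trace form of the algebra. Multiplications are self-adjoint for it, which the inner
  product of the type does not guarantee.\<close>

definition tau :: "'a \<Rightarrow> 'a \<Rightarrow> real" where
  "tau x y = trace_op ((\<odot>) (x \<odot> y))"

lemma tau_commute: "tau x y = tau y x"
  by (simp add: tau_def comm)

lemma tau_add_left: "tau (x + y) z = tau x z + tau y z"
  and tau_scale_left [simp]: "tau (a *\<^sub>R x) z = a * tau x z"
  by (simp_all add: tau_def trace_op_def mult_distribs inner_add_left sum.distrib sum_distrib_left)

lemma tau_add_right: "tau z (x + y) = tau z x + tau z y"
  and tau_scale_right [simp]: "tau z (a *\<^sub>R x) = a * tau z x"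
  by (simp_all add: tau_commute[of z] tau_add_left)

lemma tau_zero [simp]: "tau 0 x = 0" "tau x 0 = 0"
  using tau_scale_left[of 0 0 x] tau_scale_right[of x 0 0] by simp_all

lemma tau_minus_left [simp]: "tau (- x) y = - tau x y"
  using tau_scale_left[of "-1" x y] by simp

lemma tau_diff_left: "tau (x - y) z = tau x z - tau y z"
  using tau_add_left[of x "- y" z] by simp

lemma tau_diff_right: "tau z (x - y) = tau z x - tau z y"
  by (simp add: tau_commute[of z] tau_diff_left)

lemma tau_sum_left: "tau (sum f A) x = (\<Sum>i\<in>A. tau (f i) x)"
  by (induction A rule: infinite_finite_induct) (simp_all add: tau_add_left)

lemma bilinear_tau: "bilinear tau"
  unfolding bilinear_def by (auto intro!: linearI simp: tau_add_left tau_add_right)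

text \<open>Expanding both triple products by \<open>mult_triple\<close> and subtracting leaves four
  compositions of three multiplications. Their traces cancel in pairs by cyclic invariance.\<close>

lemma tau_assoc: "tau (x \<odot> y) z = tau x (y \<odot> z)"
proof -
  have lin: "linear (\<lambda>v. x \<odot> (y \<odot> v))" "linear (\<lambda>v. y \<odot> (x \<odot> v))" for x y
    using linear_compose[OF linear_mult linear_mult] by (simp_all add: o_def)
  let ?T = "\<lambda>x y z. trace_op (\<lambda>v. x \<odot> (y \<odot> (z \<odot> v)))"
  have cyc: "?T x y z = ?T y z x" for x y z
    by (rule trace_op_commute[OF linear_mult lin(1)])
  have "((x \<odot> y) \<odot> z) \<odot> v - (x \<odot> (y \<odot> z)) \<odot> v
    = (y \<odot> (x \<odot> (z \<odot> v)) - x \<odot> (z \<odot> (y \<odot> v))) + (z \<odot> (x \<odot> (y \<odot> v)) - y \<odot> (z \<odot> (x \<odot> v)))" for v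
    using mult_triple[of x y z v] mult_triple[of z y x v]
    by (simp add: comm[of x "y \<odot> z"] comm[of z y] comm[of z x] comm[of y x])
  then have "trace_op ((\<odot>) ((x \<odot> y) \<odot> z)) - trace_op ((\<odot>) (x \<odot> (y \<odot> z)))
     = (?T y x z - ?T x z y) + (?T z x y - ?T y z x)"
    unfolding trace_op_diff[symmetric] trace_op_add[symmetric] by simp
  moreover have "?T y x z = ?T x z y" by (rule cyc)
  moreover have "?T z x y = ?T y z x" by (rule trans[OF cyc cyc])
  ultimately show ?thesis unfolding tau_def by linarith
qed

lemma tau_mult_left: "tau (c \<odot> x) y = tau x (c \<odot> y)"
  by (simp add: comm[of c x] tau_assoc)

text \<open>Multiplication by \<open>c\<close> is the first Peirce projection plus half of the
  second. Projections have nonnegative trace, and the first one fixes \<open>c\<close>, so its trace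
  is positive.\<close>

lemma trace_op_idempotent:
  assumes "c \<odot> c = c" "c \<noteq> 0"
  shows "0 < trace_op ((\<odot>) c)"
proof -
  have "(\<odot>) c = (\<lambda>x. peirce1 c x + (1/2) *\<^sub>R peirceh c x)" using mult_eq_peirce by blast
  then have "trace_op ((\<odot>) c) = trace_op (peirce1 c) + (1/2) * trace_op (peirceh c)"
    by (simp only: trace_op_add trace_op_scale)
  moreover have "0 < trace_op (peirce1 c)"
    by (rule trace_op_projection(2)[OF linear_peirce(1) _ _ assms(2)])
      (simp_all add: peirce_of_eigen peirce_eigen assms)
  moreover have "0 \<le> trace_op (peirceh c)"
    by (rule trace_op_projection(1)[OF linear_peirce(2)]) (simp add: peirce_of_eigen peirce_eigen assms)
  ultimately show ?thesis by simp
qed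

section \<open>Calculus in a frame and positivity of the trace form\<close>

context
  fixes P assumes P: "frame P"
begin

lemma frame_finite [simp]: "finite P"
  and frame_nonzero: "p \<in> P \<Longrightarrow> p \<noteq> 0"
  and frame_idem: "p \<in> P \<Longrightarrow> p \<odot> p = p"
  and frame_orth: "p \<in> P \<Longrightarrow> q \<in> P \<Longrightarrow> p \<noteq> q \<Longrightarrow> p \<odot> q = 0"
  and frame_sum: "\<Sum>P = u"
  using P by (auto simp: frame_def)

lemma frame_nonempty: "P \<noteq> {}"
  using frame_sum u_nonzero by auto

lemma frame_comb_eigen:
  assumes p: "p \<in> P"
  shows "(\<Sum>q\<in>P. f q *\<^sub>R q) \<odot> p = f p *\<^sub>R p"
proof -
  have "(\<Sum>q\<in>P. f q *\<^sub>R q) \<odot> p = (\<Sum>q\<in>P. if q = p then f p *\<^sub>R p else 0)"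
    unfolding mult_sum_left using p by (intro sum.cong) (auto simp: frame_idem frame_orth)
  then show ?thesis using p by simp
qed

lemma frame_comb_mult:
  "(\<Sum>p\<in>P. f p *\<^sub>R p) \<odot> (\<Sum>p\<in>P. g p *\<^sub>R p) = (\<Sum>p\<in>P. (f p * g p) *\<^sub>R p)"
  unfolding mult_sum_right[of _ "\<lambda>p. g p *\<^sub>R p"]
  by (intro sum.cong) (simp_all add: frame_comb_eigen mult.commute)

lemma frame_scale_u: "a *\<^sub>R u = (\<Sum>p\<in>P. a *\<^sub>R p)"
  by (simp flip: scaleR_sum_right add: frame_sum)

end

lemma tau_pos: "x \<noteq> 0 \<Longrightarrow> 0 < tau x x"
proof -
  assume x0: "x \<noteq> 0"
  obtain P f where P: "frame P" and x: "x = (\<Sum>p\<in>P. f p *\<^sub>R p)"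
    using spectral_decomposition by blast
  have "(\<odot>) (x \<odot> x) = (\<lambda>v. \<Sum>p\<in>P. (f p * f p) *\<^sub>R (p \<odot> v))"
    unfolding x frame_comb_mult[OF P] by (rule ext) (simp add: mult_sum_left)
  then have t: "tau x x = (\<Sum>p\<in>P. (f p * f p) * trace_op ((\<odot>) p))"
    unfolding tau_def trace_op_def
    by (simp add: inner_sum_left sum_distrib_left) (rule sum.swap)
  have pos: "0 < trace_op ((\<odot>) p)" if "p \<in> P" for p
    using that P frame_idem frame_nonzero by (intro trace_op_idempotent) auto
  obtain p where p: "p \<in> P" "f p \<noteq> 0" 
  proof (rule ccontr)
    assume "\<not> thesis"
    with that have "f p = 0" if "p \<in> P" for p using that by blast
    then show False using x0 unfolding x by simp
  qed
  show ?thesis unfolding t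
    using P p pos by (intro sum_pos2[of P p]) (auto simp: less_imp_le zero_less_mult_iff)
qed

lemma tau_nonneg: "0 \<le> tau x x"
  by (cases "x = 0") (auto simp: less_imp_le tau_pos)

text \<open>Since the Peirce projections are self-adjoint for \<open>tau\<close>, the form at
  \<open>c \<odot> y\<close> and \<open>y\<close> is the squared length of the first component of
  \<open>y\<close> plus half that of the second; it vanishes only if both components do.\<close>

lemma tau_idempotent:
  assumes c: "c \<odot> c = c"
  shows "0 \<le> tau (c \<odot> y) y" "tau (c \<odot> y) y = 0 \<Longrightarrow> c \<odot> y = 0"
proof -
  have sa: "tau (peirce1 c x) y = tau x (peirce1 c y)" "tau (peirceh c x) y = tau x (peirceh c y)" for x y
    unfolding peirce1_def peirceh_def
    by (simp_all add: tau_mult_left tau_diff_left tau_diff_right)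
  have "tau (peirce1 c y) y = tau (peirce1 c y) (peirce1 c y)"
    "tau (peirceh c y) y = tau (peirceh c y) (peirceh c y)"
    using c sa(1)[of "peirce1 c y" y] sa(2)[of "peirceh c y" y] by (simp_all add: peirce_of_eigen peirce_eigen)
  then have e: "tau (c \<odot> y) y = tau (peirce1 c y) (peirce1 c y) + (1/2) * tau (peirceh c y) (peirceh c y)"
    by (simp only: mult_eq_peirce tau_add_left tau_scale_left)
  then show "0 \<le> tau (c \<odot> y) y" using tau_nonneg by simp
  assume "tau (c \<odot> y) y = 0"
  then have "tau (peirce1 c y) (peirce1 c y) = 0" "tau (peirceh c y) (peirceh c y) = 0"
    using e tau_nonneg[of "peirce1 c y"] tau_nonneg[of "peirceh c y"] by linarith+
  then have "peirce1 c y = 0" "peirceh c y = 0" by (metis less_irrefl tau_pos)+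
  then show "c \<odot> y = 0" using mult_eq_peirce[of c y] by simp
qed

section \<open>The symmetric cone and inversion\<close>

abbreviation C :: "'a set" where "C \<equiv> Defs.cone (\<odot>)"
abbreviation C\<^sub>0 :: "'a set" where "C\<^sub>0 \<equiv> icone (\<odot>)"
abbreviation jinverse :: "'a \<Rightarrow> 'a" where "jinverse \<equiv> jinv (\<odot>) u"

lemma frame_comb_diff_u:
  "frame P \<Longrightarrow> (\<Sum>p\<in>P. f p *\<^sub>R p) - a *\<^sub>R u = (\<Sum>p\<in>P. (f p - a) *\<^sub>R p)"
  by (simp add: frame_scale_u scaleR_diff_left sum_subtractf)

lemma tau_frame_comb_eigen:
  "frame P \<Longrightarrow> p \<in> P \<Longrightarrow> tau ((\<Sum>q\<in>P. f q *\<^sub>R q) \<odot> p) p = f p * tau p p"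
  by (simp add: frame_comb_eigen)

lemma cone_comb_nonneg:
  assumes "frame P" "\<And>p. p \<in> P \<Longrightarrow> 0 \<le> f p"
  shows "(\<Sum>p\<in>P. f p *\<^sub>R p) \<in> C"
proof -
  let ?w = "\<Sum>p\<in>P. sqrt (f p) *\<^sub>R p"
  have "?w \<odot> ?w = (\<Sum>p\<in>P. f p *\<^sub>R p)"
    unfolding frame_comb_mult[OF assms(1)] using assms(2) by simp
  then show ?thesis unfolding Defs.cone_def by (metis (mono_tags, lifting) mem_Collect_eq)
qed

lemma cone_tau_nonneg:
  assumes "x \<in> C"
  shows "0 \<le> tau (x \<odot> v) v"
proof -
  obtain w where w: "x = w \<odot> w" using assms by (auto simp: Defs.cone_def)
  obtain P f where P: "frame P" and wf: "w = (\<Sum>p\<in>P. f p *\<^sub>R p)"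
    using spectral_decomposition by blast
  have "x = (\<Sum>p\<in>P. (f p * f p) *\<^sub>R p)" unfolding w wf by (rule frame_comb_mult[OF P])
  then have "tau (x \<odot> v) v = (\<Sum>p\<in>P. (f p * f p) * tau (p \<odot> v) v)"
    by (simp add: mult_sum_left tau_sum_left)
  also have "0 \<le> \<dots>" 
    by (intro sum_nonneg mult_nonneg_nonneg[OF zero_le_square tau_idempotent(1)[OF frame_idem[OF P]]])
  finally show ?thesis .
qed

lemma frame_comb_nonneg:
  assumes P: "frame P" and p: "p \<in> P" and "\<And>v. 0 \<le> tau ((\<Sum>q\<in>P. f q *\<^sub>R q) \<odot> v) v"
  shows "0 \<le> f p"
proof -
  have "0 \<le> f p * tau p p" using assms(3)[of p] unfolding tau_frame_comb_eigen[OF P p] .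
  moreover have "0 < tau p p" by (rule tau_pos) (rule frame_nonzero[OF P p])
  ultimately show ?thesis using zero_le_mult_iff[of "f p" "tau p p"] by linarith
qed

text \<open>Being a square is replaced by one linear inequality in \<open>x\<close> for each
  \<open>v\<close>. Additivity and closedness of the cone then need no square roots.\<close>

lemma cone_iff_tau: "x \<in> C \<longleftrightarrow> (\<forall>v. 0 \<le> tau (x \<odot> v) v)"
proof
  assume *: "\<forall>v. 0 \<le> tau (x \<odot> v) v"
  obtain P f where P: "frame P" and x: "x = (\<Sum>p\<in>P. f p *\<^sub>R p)"
    using spectral_decomposition by blast
  show "x \<in> C" using * unfolding x by (intro cone_comb_nonneg[OF P]) (auto intro: frame_comb_nonneg[OF P])
qed (simp add: cone_tau_nonneg)

lemma cone_comb_iff: "frame P \<Longrightarrow> (\<Sum>p\<in>P. f p *\<^sub>R p) \<in> C \<longleftrightarrow> (\<forall>p\<in>P. 0 \<le> f p)"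
  using cone_comb_nonneg frame_comb_nonneg cone_tau_nonneg by metis

lemma cone_add: "x \<in> C \<Longrightarrow> y \<in> C \<Longrightarrow> x + y \<in> C"
  by (simp add: cone_iff_tau mult_distribs tau_add_left)

lemma cone_scale: "0 \<le> a \<Longrightarrow> x \<in> C \<Longrightarrow> a *\<^sub>R x \<in> C"
  by (simp add: cone_iff_tau)

lemma zero_in_cone [simp]: "0 \<in> C"
  by (simp add: cone_iff_tau)

lemma u_in_cone: "u \<in> C"
  by (simp add: cone_iff_tau tau_nonneg)

lemma cone_pointed: "x \<in> C \<Longrightarrow> - x \<in> C \<Longrightarrow> x = 0"
proof -
  assume "x \<in> C" "- x \<in> C"
  then obtain v w where "x = v \<odot> v" "- x = w \<odot> w" by (auto simp: Defs.cone_def)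
  then have "v \<odot> v + w \<odot> w = 0" by (metis add.right_inverse)
  then have "v = 0" using formally_real[of v w] by simp
  then show "x = 0" using \<open>x = v \<odot> v\<close> by simp
qed

lemma closed_cone: "closed C"
proof -
  have "continuous_on UNIV (\<lambda>x. tau (x \<odot> v) v)" for v
    by (intro linear_continuous_on linear_linear[THEN iffD2] linearI) (simp_all add: mult_distribs tau_add_left)
  then have "closed {x. \<forall>v. 0 \<le> tau (x \<odot> v) v}"
    by (intro closed_Collect_all closed_Collect_le continuous_intros)
  moreover have "C = {x. \<forall>v. 0 \<le> tau (x \<odot> v) v}" using cone_iff_tau by blast
  ultimately show ?thesis by simp
qed

lemma tau_coercive: "\<exists>c>0. \<forall>v. c * (norm v * norm v) \<le> tau v v"
proof -
  have cont: "continuous_on (sphere 0 1) (\<lambda>v. tau v v)"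
    using bilinear_conv_bounded_bilinear[of tau] bilinear_tau
    by (intro bounded_bilinear.continuous_on[of tau] continuous_intros) auto
  have "sphere (0::'a) 1 \<noteq> {}" by simp
  then obtain v0 where v0: "v0 \<in> sphere 0 1" "\<And>v. v \<in> sphere 0 1 \<Longrightarrow> tau v0 v0 \<le> tau v v"
    using continuous_attains_inf[OF compact_sphere _ cont] by blast
  define c where "c = tau v0 v0"
  have c: "c > 0" using v0(1) unfolding c_def by (intro tau_pos) auto
  have "c * (norm v * norm v) \<le> tau v v" for v
  proof (cases "v = 0")
    case False
    then have "c \<le> tau (inverse (norm v) *\<^sub>R v) (inverse (norm v) *\<^sub>R v)"
      unfolding c_def by (intro v0) auto
    also have "\<dots> = tau v v / (norm v * norm v)" by (simp add: field_simps)
    finally show ?thesis using False by (simp add: field_simps)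
  qed simp
  then show ?thesis using c by blast
qed

lemma order_unit: "\<exists>K>0. \<forall>a. (K * norm a) *\<^sub>R u - a \<in> C"
proof -
  obtain T where T: "T > 0" "\<And>x y. \<bar>tau x y\<bar> \<le> T * norm x * norm y"
    using bilinear_bounded_pos[OF bilinear_tau] by auto
  obtain B where B: "B > 0" "\<And>x y. norm (x \<odot> y) \<le> B * norm x * norm y"
    using bilinear_bounded_pos[OF bil] by auto
  obtain c where c: "c > 0" and low: "\<And>v. c * (norm v * norm v) \<le> tau v v"
    using tau_coercive by blast
  \<comment> \<open>\<open>T\<close> bounds the trace form, \<open>B\<close> the product, and
    \<open>c\<close> is the coercivity constant: the form at \<open>a \<odot> v\<close> and
    \<open>v\<close> is at most T B |a| |v|^2, hence at most (T B / c) |a| times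
    \<open>tau v v\<close>.\<close>
  show ?thesis
  proof (intro exI[of _ "T * B / c"] conjI allI)
    show "0 < T * B / c" using T B c by simp
    fix a
    show "(T * B / c * norm a) *\<^sub>R u - a \<in> C"
      unfolding cone_iff_tau
    proof
      fix v
      have "tau (a \<odot> v) v \<le> T * norm (a \<odot> v) * norm v" using T(2)[of "a \<odot> v" v] by simp
      also have "\<dots> \<le> T * (B * norm a * norm v) * norm v"
        using T B by (intro mult_right_mono mult_left_mono) auto
      also have "\<dots> = (T * B / c * norm a) * (c * (norm v * norm v))" using c by simp
      also have "\<dots> \<le> (T * B / c * norm a) * tau v v" using T B c low by (intro mult_left_mono) auto
      finally show "0 \<le> tau (((T * B / c * norm a) *\<^sub>R u - a) \<odot> v) v"
        by (simp add: mult_distribs tau_diff_left)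
    qed
  qed
qed

text \<open>A ball inside the cone leaves room to subtract a small multiple of \<open>u\<close>.
  Conversely \<open>u\<close> is an order unit, so the slack \<open>e\<close> absorbs every
  perturbation of norm below \<open>e / K\<close>.\<close>

lemma icone_iff: "x \<in> C\<^sub>0 \<longleftrightarrow> (\<exists>e>0. x - e *\<^sub>R u \<in> C)"
proof
  assume "x \<in> C\<^sub>0"
  then obtain r where r: "r > 0" "cball x r \<subseteq> C" unfolding icone_def mem_interior_cball by blast
  have "x - (r / norm u) *\<^sub>R u \<in> cball x r" using r(1) u_nonzero by (simp add: dist_norm)
  then show "\<exists>e>0. x - e *\<^sub>R u \<in> C" using r u_nonzero by (intro exI[of _ "r / norm u"]) auto
next
  assume "\<exists>e>0. x - e *\<^sub>R u \<in> C"
  then obtain e where e: "e > 0" "x - e *\<^sub>R u \<in> C" by blast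
  obtain K where K: "K > 0" "\<And>a. (K * norm a) *\<^sub>R u - a \<in> C" using order_unit by blast
  have "ball x (e / K) \<subseteq> C"
  proof
    fix y assume "y \<in> ball x (e / K)"
    then have "K * norm (x - y) \<le> e" using K(1) by (simp add: dist_norm field_simps)
    then have "(e - K * norm (x - y)) *\<^sub>R u \<in> C" by (intro cone_scale u_in_cone) simp
    then have "(x - e *\<^sub>R u) + ((e - K * norm (x - y)) *\<^sub>R u + ((K * norm (x - y)) *\<^sub>R u - (x - y))) \<in> C"
      using e K(2)[of "x - y"] by (intro cone_add)
    then show "y \<in> C" by (simp add: algebra_simps)
  qed
  then show "x \<in> C\<^sub>0" unfolding icone_def mem_interior using e K(1) by (intro exI[of _ "e / K"]) auto
qed

lemma open_icone: "open C\<^sub>0"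
  by (simp add: icone_def)

lemma icone_comb_iff:
  assumes P: "frame P"
  shows "(\<Sum>p\<in>P. f p *\<^sub>R p) \<in> C\<^sub>0 \<longleftrightarrow> (\<forall>p\<in>P. 0 < f p)"
proof
  assume *: "\<forall>p\<in>P. 0 < f p"
  have "0 < Min (f ` P)" using * P frame_nonempty[OF P] by simp
  moreover have "\<forall>p\<in>P. Min (f ` P) \<le> f p" using P by simp
  ultimately show "(\<Sum>p\<in>P. f p *\<^sub>R p) \<in> C\<^sub>0"
    unfolding icone_iff frame_comb_diff_u[OF P] cone_comb_iff[OF P] by (intro exI[of _ "Min (f ` P)"]) auto
next
  assume "(\<Sum>p\<in>P. f p *\<^sub>R p) \<in> C\<^sub>0"
  then show "\<forall>p\<in>P. 0 < f p"
    unfolding icone_iff frame_comb_diff_u[OF P] cone_comb_iff[OF P] by fastforce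
qed

lemma icone_subset: "x \<in> C\<^sub>0 \<Longrightarrow> x \<in> C"
  using interior_subset unfolding icone_def by blast

lemma u_in_icone: "u \<in> C\<^sub>0"
  unfolding icone_iff by (intro exI[of _ 1]) simp

lemma icone_add: "x \<in> C\<^sub>0 \<Longrightarrow> y \<in> C \<Longrightarrow> x + y \<in> C\<^sub>0"
  unfolding icone_iff by (metis add_diff_eq add.commute cone_add)

lemma icone_scale: "0 < a \<Longrightarrow> x \<in> C\<^sub>0 \<Longrightarrow> a *\<^sub>R x \<in> C\<^sub>0"
proof -
  assume a: "0 < a" and "x \<in> C\<^sub>0"
  then obtain e where e: "e > 0" "x - e *\<^sub>R u \<in> C" unfolding icone_iff by blast
  then have "a *\<^sub>R (x - e *\<^sub>R u) \<in> C" using a by (intro cone_scale) auto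
  then show "a *\<^sub>R x \<in> C\<^sub>0" unfolding icone_iff using a e
    by (intro exI[of _ "a * e"]) (simp add: scaleR_diff_right)
qed

lemma icone_tau_pos: "x \<in> C\<^sub>0 \<Longrightarrow> v \<noteq> 0 \<Longrightarrow> 0 < tau (x \<odot> v) v"
proof -
  assume "x \<in> C\<^sub>0" and v: "v \<noteq> 0"
  then obtain e where e: "e > 0" "x - e *\<^sub>R u \<in> C" unfolding icone_iff by blast
  have "0 \<le> tau ((x - e *\<^sub>R u) \<odot> v) v" using e by (intro cone_tau_nonneg)
  then have "e * tau v v \<le> tau (x \<odot> v) v" by (simp add: mult_distribs tau_diff_left)
  moreover have "0 < e * tau v v" using e tau_pos[OF v] by simp
  ultimately show ?thesis by linarith
qed

lemma icone_mult_cancel: "x \<in> C\<^sub>0 \<Longrightarrow> x \<odot> v = x \<odot> w \<Longrightarrow> v = w"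
  using icone_tau_pos[of x "v - w"] by (cases "v = w") (simp_all add: mult_distribs)

lemma icone_nonzero: "x \<in> C\<^sub>0 \<Longrightarrow> x \<noteq> 0"
  using icone_tau_pos[OF _ u_nonzero] by fastforce

lemma comb_coeff_nonzero:
  assumes P: "frame P" and "(\<Sum>q\<in>P. f q *\<^sub>R q) \<odot> y = u" and p: "p \<in> P"
  shows "f p \<noteq> 0"
proof
  let ?x = "\<Sum>q\<in>P. f q *\<^sub>R q"
  assume "f p = 0"
  then have "?x \<odot> p = 0" unfolding frame_comb_eigen[OF P p] by simp
  then have "tau y (?x \<odot> p) = 0" by simp
  then have "tau u p = 0" by (metis assms(2) comm tau_assoc)
  moreover have "tau u p = tau p p" using frame_idem[OF P p] by (metis tau_assoc unit_left)
  ultimately show False using tau_pos[of p] frame_nonzero[OF P p] by simp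
qed

text \<open>A boundary point of the cone has a vanishing coefficient in its frame, which excludes a
  solution of \<open>x \<odot> y = u\<close>. Thus interior points are recognised by an equation
  that survives limits.\<close>

lemma icone_if_mult_eq_u:
  assumes x: "x \<in> C" and xy: "x \<odot> y = u"
  shows "x \<in> C\<^sub>0"
proof -
  obtain P f where P: "frame P" and xf: "x = (\<Sum>p\<in>P. f p *\<^sub>R p)"
    using spectral_decomposition by blast
  have "0 \<le> f p" if "p \<in> P" for p using x that unfolding xf cone_comb_iff[OF P] by blast
  moreover have "f p \<noteq> 0" if "p \<in> P" for p using comb_coeff_nonzero[OF P _ that] xy xf by metis
  ultimately show ?thesis unfolding xf icone_comb_iff[OF P] by (simp add: less_le)
qed

text \<open>Makes the Jordan inverse unique: in \<open>(x \<odot> x) \<odot> y = x\<close> the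
  square is interior and can be cancelled.\<close>

lemma jinvertible_square:
  assumes "x \<odot> y = u"
  shows "x \<odot> x \<in> C\<^sub>0"
proof -
  obtain P f where P: "frame P" and xf: "x = (\<Sum>p\<in>P. f p *\<^sub>R p)"
    using spectral_decomposition by blast
  have "f p \<noteq> 0" if "p \<in> P" for p using comb_coeff_nonzero[OF P _ that] assms xf by metis
  then have "0 < f p * f p" if "p \<in> P" for p using that not_real_square_gt_zero by metis
  then show ?thesis unfolding xf frame_comb_mult[OF P] icone_comb_iff[OF P] by blast
qed

lemma jinverse_eqI: "x \<odot> y = u \<Longrightarrow> (x \<odot> x) \<odot> y = x \<Longrightarrow> jinverse x = y"
  unfolding jinv_def using jinvertible_square icone_mult_cancel by (intro the_equality) metis+

lemma frame_comb_inverse: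
  assumes P: "frame P" and f: "\<forall>p\<in>P. f p \<noteq> 0"
  defines "x \<equiv> \<Sum>p\<in>P. f p *\<^sub>R p" and "y \<equiv> \<Sum>p\<in>P. inverse (f p) *\<^sub>R p"
  shows "x \<odot> y = u" "(x \<odot> x) \<odot> y = x"
proof -
  show "x \<odot> y = u" unfolding x_def y_def frame_comb_mult[OF P] frame_sum[OF P, symmetric]
    using f by (intro sum.cong) auto
  show "(x \<odot> x) \<odot> y = x" unfolding x_def y_def frame_comb_mult[OF P]
    using f by (intro sum.cong) auto
qed

lemma jinverse_comb:
  "frame P \<Longrightarrow> \<forall>p\<in>P. f p \<noteq> 0 \<Longrightarrow> jinverse (\<Sum>p\<in>P. f p *\<^sub>R p) = (\<Sum>p\<in>P. inverse (f p) *\<^sub>R p)"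
  by (intro jinverse_eqI frame_comb_inverse)

lemma jinvertible_comb_iff:
  assumes P: "frame P"
  shows "jinvertible (\<odot>) u (\<Sum>p\<in>P. f p *\<^sub>R p) \<longleftrightarrow> (\<forall>p\<in>P. f p \<noteq> 0)"
proof
  assume "jinvertible (\<odot>) u (\<Sum>p\<in>P. f p *\<^sub>R p)"
  then obtain y where "(\<Sum>p\<in>P. f p *\<^sub>R p) \<odot> y = u" unfolding jinvertible_def by blast
  then show "\<forall>p\<in>P. f p \<noteq> 0" using comb_coeff_nonzero[OF P] by blast
next
  assume "\<forall>p\<in>P. f p \<noteq> 0"
  from frame_comb_inverse[OF P this] show "jinvertible (\<odot>) u (\<Sum>p\<in>P. f p *\<^sub>R p)"
    unfolding jinvertible_def by blast
qed

lemma jspectrum_comb: "frame P \<Longrightarrow> jspectrum (\<odot>) u (\<Sum>p\<in>P. f p *\<^sub>R p) = f ` P"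
  unfolding jspectrum_def by (auto simp: frame_comb_diff_u jinvertible_comb_iff)

lemma icone_comb:
  assumes "x \<in> C\<^sub>0"
  obtains P f where "frame P" "\<forall>p\<in>P. 0 < f p" "x = (\<Sum>p\<in>P. f p *\<^sub>R p)"
  using spectral_decomposition[of x] icone_comb_iff assms by metis

lemma jinverse_props:
  assumes x: "x \<in> C\<^sub>0"
  shows mult_jinverse: "x \<odot> jinverse x = u"
    and jinverse_in_icone: "jinverse x \<in> C\<^sub>0"
    and jinverse_jinverse: "jinverse (jinverse x) = x"
    and mult_jinverse_commute: "x \<odot> (jinverse x \<odot> v) = jinverse x \<odot> (x \<odot> v)"
proof -
  obtain P f where P: "frame P" and f: "\<forall>p\<in>P. 0 < f p" and xf: "x = (\<Sum>p\<in>P. f p *\<^sub>R p)"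
    using icone_comb[OF x] .
  have f0: "\<forall>p\<in>P. f p \<noteq> 0" using f by auto
  have i: "jinverse x = (\<Sum>p\<in>P. inverse (f p) *\<^sub>R p)" unfolding xf by (rule jinverse_comb[OF P f0])
  show "x \<odot> jinverse x = u" unfolding i unfolding xf by (rule frame_comb_inverse[OF P f0])
  show "jinverse x \<in> C\<^sub>0" unfolding i icone_comb_iff[OF P] using f by simp
  show "jinverse (jinverse x) = x" unfolding i using f0 by (subst jinverse_comb[OF P]) (simp_all add: xf)
  have com: "p \<odot> (q \<odot> v) = q \<odot> (p \<odot> v)" if "p \<in> P" "q \<in> P" for p q
    using eigen_commute[OF frame_idem[OF P that(1)], of q 0 v] frame_orth[OF P that] by (cases "p = q") auto
  have "x \<odot> (p \<odot> v) = p \<odot> (x \<odot> v)" if "p \<in> P" for p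
    unfolding xf by (simp add: mult_sum_left mult_sum_right com[OF that])
  then show "x \<odot> (jinverse x \<odot> v) = jinverse x \<odot> (x \<odot> v)"
    unfolding i by (simp add: mult_sum_left mult_sum_right)
qed

lemma jinverse_mult_unique: "x \<in> C\<^sub>0 \<Longrightarrow> x \<odot> y = u \<Longrightarrow> jinverse x = y"
  by (rule icone_mult_cancel[of x]) (simp_all add: mult_jinverse)

lemma jinverse_u: "jinverse u = u"
  by (rule jinverse_mult_unique[OF u_in_icone]) simp

lemma jinverse_scale: "x \<in> C\<^sub>0 \<Longrightarrow> 0 < a \<Longrightarrow> jinverse (a *\<^sub>R x) = (1/a) *\<^sub>R jinverse x"
  by (rule jinverse_mult_unique) (simp_all add: icone_scale mult_jinverse)

text \<open>Connectedness of the positive reals. The set of parameters with interior image is open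
  and contains 1. It is also closed: a limit of such images lies in the closed cone and, by
  \<open>twist_mult_inverse\<close>, still has a factor with product \<open>u\<close>, so it is
  interior.\<close>

lemma twist_icone:
  assumes c: "c \<odot> c = c" and x: "x \<in> C\<^sub>0" and s: "0 < s"
  shows "twist c s x \<in> C\<^sub>0"
proof -
  define A where "A = {t \<in> {0<..}. twist c t x \<in> C\<^sub>0}"
  have cont: "continuous_on {0<..} (\<lambda>t. twist c t x)"
    unfolding twist_def by (intro continuous_intros)
  have "twist c t x \<in> C\<^sub>0" if "t \<in> {0<..}" "twist c t x \<in> C" for t
    by (rule icone_if_mult_eq_u[OF that(2) twist_mult_inverse[OF c mult_jinverse[OF x] mult_jinverse_commute[OF x]]])
      (use that(1) in simp)
  then have "A = {0<..} \<inter> (\<lambda>t. twist c t x) -` C" by (auto simp: A_def icone_subset)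
  then have "closedin (top_of_set {0<..}) A"
    using continuous_closedin_preimage[OF cont closed_cone] by simp
  moreover have "A = {0<..} \<inter> (\<lambda>t. twist c t x) -` C\<^sub>0" by (auto simp: A_def)
  then have "openin (top_of_set {0<..}) A"
    using continuous_openin_preimage_gen[OF cont open_icone] by simp
  moreover have "connected {0::real<..}" by simp
  moreover have "1 \<in> A" using x by (simp add: A_def)
  ultimately have "A = {0<..}" unfolding connected_clopen by blast
  then show ?thesis using s by (auto simp: A_def)
qed

lemma twist_jinverse:
  assumes c: "c \<odot> c = c" and x: "x \<in> C\<^sub>0" and s: "0 < s"
  shows "jinverse (twist c s x) = twist c (1/s) (jinverse x)"
  using s by (intro jinverse_mult_unique twist_icone[OF assms]
      twist_mult_inverse[OF c mult_jinverse[OF x] mult_jinverse_commute[OF x]]) simp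

lemma twist_cone:
  assumes c: "c \<odot> c = c" and x: "x \<in> C" and s: "0 < s"
  shows "twist c s x \<in> C"
proof (rule closed_sequentially[OF closed_cone])
  show "twist c s (inverse (real (Suc n)) *\<^sub>R u + x) \<in> C" for n
    by (rule icone_subset, rule twist_icone[OF c _ s]) (intro icone_add icone_scale u_in_icone x, simp)
  have "(\<lambda>n. inverse (real (Suc n)) *\<^sub>R twist c s u + twist c s x) \<longlonglongrightarrow> 0 *\<^sub>R twist c s u + twist c s x"
    by (intro tendsto_intros LIMSEQ_inverse_real_of_nat)
  then show "(\<lambda>n. twist c s (inverse (real (Suc n)) *\<^sub>R u + x)) \<longlonglongrightarrow> twist c s x"
    by (simp add: linear_add[OF linear_twist] linear_scale[OF linear_twist])
qed

text \<open>Order reversal is proved by moving from \<open>u\<close> to an arbitrary interior point with one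
  \<open>twist\<close> for each spectral idempotent; a twist is an automorphism of the cone which turns into its
  inverse under inversion.\<close>

lemma jinverse_antimono:
  assumes x: "x \<in> C\<^sub>0" and w: "w \<in> C\<^sub>0" and le: "w - x \<in> C"
  shows "jinverse x - jinverse w \<in> C"
proof -
  \<comment> \<open>All interior points below \<open>w\<close> are included, because undoing a twist
    of \<open>w\<close> replaces \<open>x\<close> by another such point.\<close>
  define good where "good w \<longleftrightarrow> w \<in> C\<^sub>0 \<and> (\<forall>x\<in>C\<^sub>0. w - x \<in> C \<longrightarrow> jinverse x - jinverse w \<in> C)" for w
  have "good u" unfolding good_def
  proof (intro conjI ballI impI u_in_icone)
    fix x assume x: "x \<in> C\<^sub>0" and le: "u - x \<in> C"
    obtain P f where P: "frame P" and f: "\<forall>p\<in>P. 0 < f p" and xf: "x = (\<Sum>p\<in>P. f p *\<^sub>R p)"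
      using icone_comb[OF x] .
    have "u - x = (\<Sum>p\<in>P. (1 - f p) *\<^sub>R p)"
      unfolding xf using frame_scale_u[OF P, of 1] by (simp add: scaleR_diff_left sum_subtractf)
    then have "\<forall>p\<in>P. f p \<le> 1" using le cone_comb_iff[OF P, of "\<lambda>p. 1 - f p"] by simp
    moreover have "jinverse x - 1 *\<^sub>R u = (\<Sum>p\<in>P. (inverse (f p) - 1) *\<^sub>R p)"
      unfolding xf using f by (subst jinverse_comb[OF P]) (auto simp only: frame_comb_diff_u[OF P])
    ultimately show "jinverse x - jinverse u \<in> C"
      using f cone_comb_iff[OF P, of "\<lambda>p. inverse (f p) - 1"] by (simp add: jinverse_u one_le_inverse)
  qed
  have step: "good (twist c s w)" if c: "c \<odot> c = c" and s: "0 < s" and w: "good w" for c s w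
    unfolding good_def
  proof (intro conjI ballI impI)
    have w0: "w \<in> C\<^sub>0" using w by (simp add: good_def)
    show "twist c s w \<in> C\<^sub>0" using twist_icone[OF c w0 s] .
    fix x assume x: "x \<in> C\<^sub>0" and le: "twist c s w - x \<in> C"
    have inv: "twist c (1/s) (twist c s y) = y" "twist c s (twist c (1/s) y) = y" for y
      using s by (simp_all add: twist_twist[OF c])
    have s': "0 < 1/s" using s by simp
    have "twist c (1/s) (twist c s w - x) \<in> C" by (rule twist_cone[OF c le s'])
    then have "w - twist c (1/s) x \<in> C" by (simp only: linear_diff[OF linear_twist] inv)
    then have "jinverse (twist c (1/s) x) - jinverse w \<in> C"
      using w twist_icone[OF c x s'] by (simp add: good_def)
    then have "twist c s (jinverse x) - jinverse w \<in> C" by (simp add: twist_jinverse[OF c x s'])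
    then have "twist c (1/s) (twist c s (jinverse x) - jinverse w) \<in> C" by (rule twist_cone[OF c _ s'])
    then show "jinverse x - jinverse (twist c s w) \<in> C"
      by (simp only: linear_diff[OF linear_twist] inv twist_jinverse[OF c w0 s])
  qed
  obtain P f where P: "frame P" and f: "\<forall>p\<in>P. 0 < f p" and wf: "w = (\<Sum>p\<in>P. f p *\<^sub>R p)"
    using icone_comb[OF w] .
  \<comment> \<open>Frame elements in \<open>A\<close> already carry their final coefficient, the
    others still carry 1. The twist with parameter \<open>sqrt (f q)\<close> corrects the
    coefficient at \<open>q\<close>, since it scales \<open>q\<close> by the square of the parameter
    and fixes everything orthogonal to \<open>q\<close>.\<close>
  have "good (\<Sum>p\<in>P. (if p \<in> A then f p else 1) *\<^sub>R p)" if "A \<subseteq> P" "finite A" for A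
    using that(2,1)
  proof (induction A)
    case empty
    then show ?case using \<open>good u\<close> frame_sum[OF P] by simp
  next
    case (insert q A)
    define v where "v = (\<Sum>p\<in>P - {q}. (if p \<in> A then f p else 1) *\<^sub>R p)"
    have q: "q \<in> P" "q \<odot> q = q" using insert frame_idem[OF P, of q] by simp_all
    have "q \<odot> v = 0" unfolding v_def mult_sum_right
      using q P by (intro sum.neutral) (auto simp: frame_orth[OF P])
    then have "twist q (sqrt (f q)) (q + v) = f q *\<^sub>R q + v"
      using f q by (simp add: linear_add[OF linear_twist] twist_eigen[OF q(2)] less_imp_le)
    moreover have "(\<Sum>p\<in>P. (if p \<in> A then f p else 1) *\<^sub>R p) = q + v"
      unfolding v_def using q P insert by (subst sum.remove[of _ q]) auto
    moreover have "(\<Sum>p\<in>P. (if p \<in> insert q A then f p else 1) *\<^sub>R p) = f q *\<^sub>R q + v"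
      unfolding v_def using q P insert by (subst sum.remove[of _ q]) (auto intro!: sum.cong)
    ultimately show ?case using step[OF q(2), of "sqrt (f q)"] insert f q by fastforce
  qed
  from this[of P] have "good w" using P by (simp add: wf)
  then show ?thesis using x le by (simp add: good_def)
qed

section \<open>The gauge and the closure of the internal points\<close>

text \<open>The defect \<open>u - \<Sum>S\<close> is an idempotent orthogonal to \<open>S\<close>;
  it is adjoined unless it is 0.\<close>

lemma extend_to_frame:
  assumes S: "finite S" "0 \<notin> S" and idem: "\<And>p. p \<in> S \<Longrightarrow> p \<odot> p = p"
    and orth: "\<And>p q. p \<in> S \<Longrightarrow> q \<in> S \<Longrightarrow> p \<noteq> q \<Longrightarrow> p \<odot> q = 0"
  shows "\<exists>P. frame P \<and> S \<subseteq> P"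
proof -
  define r where "r = u - \<Sum>S"
  have Sp: "\<Sum>S \<odot> p = p" if "p \<in> S" for p
  proof -
    have "\<Sum>S \<odot> p = (\<Sum>q\<in>S. if q = p then p else 0)"
      unfolding mult_sum_left using that by (intro sum.cong) (simp_all add: idem orth)
    then show ?thesis using S(1) that by simp
  qed
  have rp: "r \<odot> p = 0" "p \<odot> r = 0" if "p \<in> S" for p
    using Sp[OF that] comm[of p r] by (simp_all add: r_def mult_distribs)
  have "r \<odot> \<Sum>S = 0" unfolding mult_sum_right using rp by simp
  then have rr: "r \<odot> r = r" by (simp add: r_def mult_distribs)
  show ?thesis
  proof (cases "r = 0")
    case True
    then have "\<Sum>S = u" by (simp add: r_def)
    then have "frame S" using S idem orth unfolding frame_def by blast
    then show ?thesis by blast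
  next
    case False
    have "r \<notin> S" using rp(1)[of r] rr False by auto
    then have "\<Sum>(insert r S) = u" using S(1) by (simp add: r_def)
    moreover have "finite (insert r S)" "0 \<notin> insert r S" using S False by auto
    moreover have "p \<odot> p = p" if "p \<in> insert r S" for p using that rr idem by blast
    moreover have "p \<odot> q = 0" if "p \<in> insert r S" "q \<in> insert r S" "p \<noteq> q" for p q
      using that rp orth by blast
    ultimately have "frame (insert r S)" unfolding frame_def by blast
    then show ?thesis by blast
  qed
qed

text \<open>If \<open>y \<odot> z = 0\<close>, the \<open>tau\<close> inner products of the spectral idempotents of \<open>y\<close> and \<open>z\<close> with
  positive coefficients are nonnegative and sum up to zero; hence these idempotents are orthogonal.\<close>

lemma common_frame:
  assumes y: "y \<in> C" and z: "z \<in> C" and yz: "y \<odot> z = 0"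
  obtains P f g where "frame P" "y = (\<Sum>p\<in>P. f p *\<^sub>R p)" "z = (\<Sum>p\<in>P. g p *\<^sub>R p)"
    "\<And>p. 0 \<le> f p" "\<And>p. 0 \<le> g p" "\<And>p. f p = 0 \<or> g p = 0"
proof -
  obtain P f where P: "frame P" and yf: "y = (\<Sum>p\<in>P. f p *\<^sub>R p)" using spectral_decomposition by blast
  obtain Q g where Q: "frame Q" and zg: "z = (\<Sum>q\<in>Q. g q *\<^sub>R q)" using spectral_decomposition by blast
  have f: "0 \<le> f p" if "p \<in> P" for p using y that unfolding yf cone_comb_iff[OF P] by blast
  have g: "0 \<le> g q" if "q \<in> Q" for q using z that unfolding zg cone_comb_iff[OF Q] by blast
  have orth: "p \<odot> q = 0" if p: "p \<in> P" "0 < f p" and q: "q \<in> Q" "0 < g q" for p q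
  proof -
    have pp: "p \<odot> p = p" using frame_idem[OF P p(1)] .
    have nn: "0 \<le> tau p q'" if "q' \<in> Q" for q'
      using tau_idempotent(1)[OF pp, of q'] frame_idem[OF Q that] by (metis tau_assoc)
    have "f p * tau p z = tau (y \<odot> p) z" unfolding yf frame_comb_eigen[OF P p(1)] by simp
    also have "\<dots> = tau p (y \<odot> z)" by (simp add: comm[of y p] tau_assoc)
    finally have "tau p z = 0" using yz p by simp
    then have "(\<Sum>q\<in>Q. g q * tau p q) = 0"
      unfolding zg tau_commute[of p] by (simp add: tau_sum_left)
    then have "g q * tau p q = 0" using q Q g nn by (subst (asm) sum_nonneg_eq_0_iff) auto
    then have "tau p q = 0" using q by simp
    then have "tau (p \<odot> q) q = 0" using frame_idem[OF Q q(1)] by (simp add: tau_assoc)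
    then show ?thesis by (rule tau_idempotent(2)[OF pp])
  qed
  define P' Q' where "P' = {p\<in>P. 0 < f p}" and "Q' = {q\<in>Q. 0 < g q}"
  have disj: "p \<notin> Q'" if "p \<in> P'" for p
    using that orth[of p p] frame_idem[OF P, of p] frame_nonzero[OF P, of p] by (auto simp: P'_def Q'_def)
  have "\<exists>R. frame R \<and> P' \<union> Q' \<subseteq> R"
  proof (rule extend_to_frame)
    show "finite (P' \<union> Q')" using P Q by (simp add: P'_def Q'_def)
    show "0 \<notin> P' \<union> Q'" using frame_nonzero[OF P] frame_nonzero[OF Q] by (auto simp: P'_def Q'_def)
    show "p \<odot> p = p" if "p \<in> P' \<union> Q'" for p
      using that frame_idem[OF P, of p] frame_idem[OF Q, of p] by (auto simp: P'_def Q'_def)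
    show "p \<odot> q = 0" if "p \<in> P' \<union> Q'" "q \<in> P' \<union> Q'" "p \<noteq> q" for p q
      using that frame_orth[OF P, of p q] frame_orth[OF Q, of p q] orth[of p q] orth[of q p] comm[of p q]
      by (auto simp: P'_def Q'_def)
  qed
  then obtain R where R: "frame R" "P' \<union> Q' \<subseteq> R" by blast
  \<comment> \<open>Cutting the coefficients off outside \<open>P'\<close> and \<open>Q'\<close>
    makes nonnegativity and complementarity hold for all \<open>p\<close>, not only inside the
    frame.\<close>
  define f' g' where "f' p = (if p \<in> P' then f p else 0)" and "g' p = (if p \<in> Q' then g p else 0)" for p
  have "y = (\<Sum>p\<in>P'. f p *\<^sub>R p)"
    unfolding yf P'_def using P f by (intro sum.mono_neutral_right) (auto simp: less_le)
  also have "\<dots> = (\<Sum>p\<in>R. f' p *\<^sub>R p)"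
    using R by (intro sum.mono_neutral_cong_left) (auto simp: f'_def)
  finally have 1: "y = (\<Sum>p\<in>R. f' p *\<^sub>R p)" .
  have "z = (\<Sum>p\<in>Q'. g p *\<^sub>R p)"
    unfolding zg Q'_def using Q g by (intro sum.mono_neutral_right) (auto simp: less_le)
  also have "\<dots> = (\<Sum>p\<in>R. g' p *\<^sub>R p)"
    using R by (intro sum.mono_neutral_cong_left) (auto simp: g'_def)
  finally have 2: "z = (\<Sum>p\<in>R. g' p *\<^sub>R p)" .
  have "0 \<le> f' p" "0 \<le> g' p" "f' p = 0 \<or> g' p = 0" for p
    using f g disj by (auto simp: f'_def g'_def P'_def Q'_def)
  then show ?thesis using that[OF R(1) 1 2] by blast
qed

section \<open>The gauge of an interior point\<close>

abbreviation M :: "'a \<Rightarrow> 'a \<Rightarrow> real" where "M \<equiv> Mfun (\<odot>)"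

lemma M_eqI: "(\<And>\<beta>. \<beta> *\<^sub>R y - x \<in> C \<longleftrightarrow> a \<le> \<beta>) \<Longrightarrow> M x y = a"
  unfolding Mfun_def jle_def by (simp add: atLeast_def[symmetric])

lemma icone_absorbs: "y \<in> C\<^sub>0 \<Longrightarrow> \<exists>L>0. \<forall>a. (L * norm a) *\<^sub>R y - a \<in> C"
proof -
  assume "y \<in> C\<^sub>0"
  then obtain e where e: "e > 0" "y - e *\<^sub>R u \<in> C" unfolding icone_iff by blast
  obtain K where K: "K > 0" "\<And>a. (K * norm a) *\<^sub>R u - a \<in> C" using order_unit by blast
  have "(K / e * norm a) *\<^sub>R (y - e *\<^sub>R u) + ((K * norm a) *\<^sub>R u - a) \<in> C" for a
    using e K by (intro cone_add cone_scale) auto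
  then have "(K / e * norm a) *\<^sub>R y - a \<in> C" for a using e(1) by (simp add: algebra_simps)
  then show ?thesis using e K by (intro exI[of _ "K / e"]) auto
qed

lemma icone_scale_in_cone_iff: "y \<in> C\<^sub>0 \<Longrightarrow> a *\<^sub>R y \<in> C \<longleftrightarrow> 0 \<le> a"
proof
  assume y: "y \<in> C\<^sub>0" and "a *\<^sub>R y \<in> C"
  moreover have "- (a *\<^sub>R y) \<in> C" if "a < 0"
    using cone_scale[of "- a" y] icone_subset[OF y] that by simp
  ultimately show "0 \<le> a" using cone_pointed[of "a *\<^sub>R y"] icone_nonzero[OF y] by fastforce
qed (simp add: cone_scale icone_subset)

text \<open>The infimum is attained: the admissible set is closed, and as \<open>y\<close> absorbs
  both \<open>x\<close> and \<open>- x\<close> it is nonempty and bounded below. Statements about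
  \<open>M\<close> thus become statements about membership in the cone.\<close>

lemma M_le_iff:
  assumes y: "y \<in> C\<^sub>0"
  shows "\<beta> *\<^sub>R y - x \<in> C \<longleftrightarrow> M x y \<le> \<beta>"
proof -
  obtain L where L: "L > 0" "\<And>a. (L * norm a) *\<^sub>R y - a \<in> C" using icone_absorbs[OF y] by blast
  define S where "S = {\<beta>. \<beta> *\<^sub>R y - x \<in> C}"
  have ne: "S \<noteq> {}" using L(2)[of x] by (auto simp: S_def)
  have bdd: "bdd_below S"
  proof (rule bdd_belowI)
    fix \<beta> assume "\<beta> \<in> S"
    then have "(\<beta> *\<^sub>R y - x) + ((L * norm (- x)) *\<^sub>R y - (- x)) \<in> C" unfolding S_def
      by (intro cone_add L) simp
    then have "(\<beta> + L * norm x) *\<^sub>R y \<in> C" by (simp add: algebra_simps)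
    then show "- (L * norm x) \<le> \<beta>" using icone_scale_in_cone_iff[OF y] by fastforce
  qed
  have "S = (\<lambda>\<beta>. \<beta> *\<^sub>R y - x) -` C" by (auto simp: S_def)
  then have "closed S" by (simp add: closed_vimage closed_cone continuous_intros)
  then have inS: "Inf S \<in> S" using ne bdd by (intro closed_contains_Inf)
  have "\<beta> \<in> S \<longleftrightarrow> Inf S \<le> \<beta>"
  proof
    assume "Inf S \<le> \<beta>"
    then have "(\<beta> - Inf S) *\<^sub>R y + (Inf S *\<^sub>R y - x) \<in> C"
      using inS icone_subset[OF y] unfolding S_def by (intro cone_add cone_scale) auto
    then show "\<beta> \<in> S" by (simp add: S_def algebra_simps)
  qed (simp add: cInf_lower bdd)
  then show ?thesis unfolding Mfun_def jle_def S_def by simp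
qed

lemma M_comb_le_iff:
  assumes P: "frame P" and g: "\<And>p. p \<in> P \<Longrightarrow> 0 < g p"
  shows "M (\<Sum>p\<in>P. f p *\<^sub>R p) (\<Sum>p\<in>P. g p *\<^sub>R p) \<le> \<beta> \<longleftrightarrow> (\<forall>p\<in>P. f p \<le> \<beta> * g p)"
proof -
  have "(\<Sum>p\<in>P. g p *\<^sub>R p) \<in> C\<^sub>0" using g by (simp add: icone_comb_iff[OF P])
  note * = M_le_iff[OF this, of \<beta> "\<Sum>p\<in>P. f p *\<^sub>R p"]
  have "\<beta> *\<^sub>R (\<Sum>p\<in>P. g p *\<^sub>R p) - (\<Sum>p\<in>P. f p *\<^sub>R p) = (\<Sum>p\<in>P. (\<beta> * g p - f p) *\<^sub>R p)"
    by (simp add: scaleR_sum_right scaleR_diff_left sum_subtractf)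
  then show ?thesis using * cone_comb_iff[OF P, of "\<lambda>p. \<beta> * g p - f p"] by simp
qed

lemma M_comb_ge:
  assumes P: "frame P" and g: "\<And>p. p \<in> P \<Longrightarrow> 0 < g p" and p: "p \<in> P" and le: "b * g p \<le> f p"
  shows "b \<le> M (\<Sum>p\<in>P. f p *\<^sub>R p) (\<Sum>p\<in>P. g p *\<^sub>R p)"
proof -
  let ?b = "M (\<Sum>p\<in>P. f p *\<^sub>R p) (\<Sum>p\<in>P. g p *\<^sub>R p)"
  have "?b \<le> ?b \<longleftrightarrow> (\<forall>p\<in>P. f p \<le> ?b * g p)" by (rule M_comb_le_iff[OF P g])
  then have "f p \<le> ?b * g p" using p by blast
  then show ?thesis using le g[OF p] by (meson mult_le_cancel_right_pos order_trans)
qed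

lemma M_scale_left:
  assumes y: "y \<in> C\<^sub>0" and a: "0 < a"
  shows "M (a *\<^sub>R x) y = a * M x y"
proof (rule M_eqI)
  fix \<beta>
  have "\<beta> *\<^sub>R y - a *\<^sub>R x = a *\<^sub>R ((\<beta> / a) *\<^sub>R y - x)" using a by (simp add: scaleR_diff_right)
  moreover have "a *\<^sub>R v \<in> C \<longleftrightarrow> v \<in> C" for v
    using cone_scale[of a v] cone_scale[of "1/a" "a *\<^sub>R v"] a by auto
  ultimately have "\<beta> *\<^sub>R y - a *\<^sub>R x \<in> C \<longleftrightarrow> (\<beta> / a) *\<^sub>R y - x \<in> C" by simp
  also have "\<dots> \<longleftrightarrow> M x y \<le> \<beta> / a" by (rule M_le_iff[OF y])
  finally show "\<beta> *\<^sub>R y - a *\<^sub>R x \<in> C \<longleftrightarrow> a * M x y \<le> \<beta>"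
    using a by (simp add: field_simps)
qed

lemma M_zero [simp]: "y \<in> C\<^sub>0 \<Longrightarrow> M 0 y = 0"
  by (rule M_eqI) (simp add: icone_scale_in_cone_iff)

lemma M_pos: "x \<in> C \<Longrightarrow> x \<noteq> 0 \<Longrightarrow> y \<in> C\<^sub>0 \<Longrightarrow> 0 < M x y"
proof (rule ccontr)
  assume x: "x \<in> C" "x \<noteq> 0" and y: "y \<in> C\<^sub>0" and "\<not> 0 < M x y"
  then have "- x \<in> C" using M_le_iff[OF y, of 0 x] by simp
  then show False using x cone_pointed by blast
qed

lemma continuous_on_M: "y \<in> C\<^sub>0 \<Longrightarrow> continuous_on UNIV (\<lambda>x. M x y)"
proof -
  assume y: "y \<in> C\<^sub>0"
  obtain L where L: "L > 0" "\<And>a. (L * norm a) *\<^sub>R y - a \<in> C" using icone_absorbs[OF y] by blast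
  have le: "M x y \<le> M x' y + L * norm (x - x')" for x x'
  proof -
    have "(M x' y *\<^sub>R y - x') + ((L * norm (x - x')) *\<^sub>R y - (x - x')) \<in> C"
      using M_le_iff[OF y] by (intro cone_add L) simp
    then show ?thesis by (simp add: algebra_simps flip: M_le_iff[OF y])
  qed
  have "\<bar>M x y - M x' y\<bar> \<le> L * norm (x - x')" for x x'
    using le[of x x'] le[of x' x] by (simp add: norm_minus_commute[of x' x])
  then have "L-lipschitz_on UNIV (\<lambda>x. M x y)"
    using L(1) by (intro lipschitz_onI) (auto simp: dist_norm)
  then show ?thesis by (rule lipschitz_on_continuous_on)
qed

lemma tendsto_M: "y \<in> C\<^sub>0 \<Longrightarrow> (f \<longlongrightarrow> x) F \<Longrightarrow> ((\<lambda>t. M (f t) y) \<longlongrightarrow> M x y) F"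
  using continuous_on_M continuous_on_tendsto_compose[of UNIV "\<lambda>x. M x y"] by auto

lemma unorm_comb: "frame P \<Longrightarrow> unorm (\<odot>) u (\<Sum>p\<in>P. f p *\<^sub>R p) = Max ((\<lambda>p. \<bar>f p\<bar>) ` P)"
  by (simp add: unorm_def jspectrum_comb image_image)

lemma unorm_eq_M: "y \<in> C \<Longrightarrow> unorm (\<odot>) u y = M y u"
proof -
  assume y: "y \<in> C"
  obtain P f where P: "frame P" and yf: "y = (\<Sum>p\<in>P. f p *\<^sub>R p)" using spectral_decomposition by blast
  have f: "0 \<le> f p" if "p \<in> P" for p using y that unfolding yf cone_comb_iff[OF P] by blast
  have u: "u = (\<Sum>p\<in>P. 1 *\<^sub>R p)" using frame_sum[OF P] by simp
  have "M y u \<le> \<beta> \<longleftrightarrow> unorm (\<odot>) u y \<le> \<beta>" for \<beta>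
  proof -
    have "M y u \<le> \<beta> \<longleftrightarrow> (\<forall>p\<in>P. f p \<le> \<beta> * 1)" unfolding yf by (subst u) (rule M_comb_le_iff[OF P], simp)
    also have "\<dots> \<longleftrightarrow> unorm (\<odot>) u y \<le> \<beta>"
      unfolding yf unorm_comb[OF P] using P f frame_nonempty[OF P] by simp
    finally show ?thesis .
  qed
  then show ?thesis by (metis order_antisym order_refl)
qed

lemma M_jinverse:
  assumes x: "x \<in> C\<^sub>0" and w: "w \<in> C\<^sub>0"
  shows "M x w = M (jinverse w) (jinverse x)"
proof (rule M_eqI)
  fix \<beta>
  note ix = jinverse_in_icone[OF x] and iw = jinverse_in_icone[OF w]
  \<comment> \<open>Order reversal concerns positive multiples only. Positivity of both values
    settles the remaining \<beta>, for which both sides fail.\<close>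
  have "0 < M x w" "0 < M (jinverse w) (jinverse x)"
    using x w ix iw by (auto intro!: M_pos icone_subset icone_nonzero)
  moreover have "\<beta> *\<^sub>R w - x \<in> C \<longleftrightarrow> \<beta> *\<^sub>R jinverse x - jinverse w \<in> C" if b: "0 < \<beta>"
  proof
    assume "\<beta> *\<^sub>R w - x \<in> C"
    then have "jinverse x - jinverse (\<beta> *\<^sub>R w) \<in> C" by (rule jinverse_antimono[OF x icone_scale[OF b w]])
    then have "\<beta> *\<^sub>R (jinverse x - (1 / \<beta>) *\<^sub>R jinverse w) \<in> C"
      using b by (intro cone_scale) (simp_all add: jinverse_scale w)
    then show "\<beta> *\<^sub>R jinverse x - jinverse w \<in> C" using b by (simp add: scaleR_diff_right)
  next
    assume "\<beta> *\<^sub>R jinverse x - jinverse w \<in> C"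
    then have "jinverse (jinverse w) - jinverse (\<beta> *\<^sub>R jinverse x) \<in> C"
      by (rule jinverse_antimono[OF iw icone_scale[OF b ix]])
    then have "\<beta> *\<^sub>R (w - (1 / \<beta>) *\<^sub>R x) \<in> C"
      using b by (intro cone_scale) (simp_all add: jinverse_scale ix jinverse_jinverse x w)
    then show "\<beta> *\<^sub>R w - x \<in> C" using b by (simp add: scaleR_diff_right)
  qed
  ultimately show "\<beta> *\<^sub>R w - x \<in> C \<longleftrightarrow> M (jinverse w) (jinverse x) \<le> \<beta>"
    using M_le_iff[OF w, of \<beta> x] M_le_iff[OF ix, of \<beta> "jinverse w"] by (cases "0 < \<beta>") auto
qed

text \<open>The exponential of the claimed function. As \<open>M 0 x = 0\<close> at interior points,
  a vanishing component drops out of the maximum by itself, whereas \<open>ln 0 = 0\<close> would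
  spoil a maximum of logarithms. This removes the case distinction of
  \<open>horo_form\<close>.\<close>

definition pair_gauge :: "'a \<Rightarrow> 'a \<Rightarrow> 'a \<Rightarrow> real" where
  "pair_gauge y z x = max (M y x) (M z (jinverse x))"

lemma pair_gauge_pos: "y \<in> C \<Longrightarrow> z \<in> C \<Longrightarrow> y \<noteq> 0 \<or> z \<noteq> 0 \<Longrightarrow> x \<in> C\<^sub>0 \<Longrightarrow> 0 < pair_gauge y z x"
  unfolding pair_gauge_def less_max_iff_disj using M_pos jinverse_in_icone by blast

lemma pair_gauge_scale: "x \<in> C\<^sub>0 \<Longrightarrow> 0 < a \<Longrightarrow> pair_gauge (a *\<^sub>R y) (a *\<^sub>R z) x = a * pair_gauge y z x"
  by (simp add: pair_gauge_def M_scale_left jinverse_in_icone max_mult_distrib_left)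

lemma horo_form_eq:
  assumes "y \<in> C" "z \<in> C" "y \<noteq> 0 \<or> z \<noteq> 0"
  shows "horo_form (\<odot>) u y z = restrict (\<lambda>x. ln (pair_gauge y z x)) C\<^sub>0"
  unfolding horo_form_def
proof (rule restrict_ext)
  fix x assume x: "x \<in> C\<^sub>0"
  note ix = jinverse_in_icone[OF x]
  have "0 < M y x" if "y \<noteq> 0" using assms that x by (intro M_pos)
  moreover have "0 < M z (jinverse x)" if "z \<noteq> 0" using assms that ix by (intro M_pos)
  ultimately show "(if y = 0 then ln (M z (jinverse x)) else if z = 0 then ln (M y x)
      else max (ln (M y x)) (ln (M z (jinverse x)))) = ln (pair_gauge y z x)"
    using assms(3) x ix by (auto simp: pair_gauge_def ln_max)
qed

lemma thompson_eq:
  assumes x: "x \<in> C\<^sub>0" and w: "w \<in> C\<^sub>0"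
  shows "thompson (\<odot>) x w = ln (pair_gauge w (jinverse w) x)"
proof -
  have "0 < M x w" "0 < M w x" using x w by (auto intro!: M_pos icone_subset icone_nonzero)
  then show ?thesis unfolding thompson_def pair_gauge_def M_jinverse[OF x w, symmetric]
    by (simp add: ln_max max.commute)
qed

text \<open>Chaining x \<le> M(x/w) w and w \<le> M(w/x) x gives M(x/w) M(w/x) \<ge> 1, so the two
  logarithms cannot both be negative.\<close>

lemma thompson_nonneg:
  assumes x: "x \<in> C\<^sub>0" and w: "w \<in> C\<^sub>0"
  shows "0 \<le> thompson (\<odot>) x w"
proof (rule ccontr)
  assume neg: "\<not> 0 \<le> thompson (\<odot>) x w"
  have pos: "0 < M x w" "0 < M w x" using x w by (auto intro!: M_pos icone_subset icone_nonzero)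
  then have "M x w < 1" "M w x < 1" using neg unfolding thompson_def by (auto simp: not_le)
  then have "M x w * M w x < 1" using pos by (metis less_trans mult_less_cancel_left2 mult_strict_mono' mult_1 less_imp_le)
  moreover have "M x w *\<^sub>R (M w x *\<^sub>R x - w) + (M x w *\<^sub>R w - x) \<in> C"
    using pos M_le_iff[OF x] M_le_iff[OF w] by (intro cone_add cone_scale) auto
  then have "(M x w * M w x - 1) *\<^sub>R x \<in> C" by (simp add: algebra_simps)
  ultimately show False using icone_scale_in_cone_iff[OF x] by fastforce
qed

text \<open>The scale \<open>a\<close> cancels in the difference. It stays free because it is used
  both to normalise the gauge at \<open>u\<close> and as \<open>exp (- t)\<close> along a
  geodesic.\<close>

lemma hw_eq:
  assumes w: "w \<in> C\<^sub>0" and x: "x \<in> C\<^sub>0" and a: "0 < a"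
  shows "hw (\<odot>) u w x = ln (pair_gauge (a *\<^sub>R w) (a *\<^sub>R jinverse w) x) - ln (pair_gauge (a *\<^sub>R w) (a *\<^sub>R jinverse w) u)"
proof -
  have pos: "0 < pair_gauge w (jinverse w) y" if "y \<in> C\<^sub>0" for y
    using that w icone_nonzero by (intro pair_gauge_pos icone_subset jinverse_in_icone) auto
  have "pair_gauge w (jinverse w) x \<noteq> 0" "pair_gauge w (jinverse w) u \<noteq> 0"
    using pos[OF x] pos[OF u_in_icone] by linarith+
  then show ?thesis unfolding hw_def
    using x a u_in_icone
    by (simp add: thompson_eq w pair_gauge_scale ln_mult)
qed

text \<open>Asking only for a bounded multiple of \<open>u\<close> as product, instead of rescalings
  of a point and its inverse, gives a closed condition which retains the limits at infinity.\<close>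

definition horo_params :: "('a \<times> 'a) set" where
  "horo_params = {(y, z). y \<in> C \<and> z \<in> C \<and> pair_gauge y z u = 1 \<and> (\<exists>s\<in>{0..1}. y \<odot> z = s *\<^sub>R u)}"

lemma pair_gauge_u: "pair_gauge y z u = max (M y u) (M z u)"
  by (simp add: pair_gauge_def jinverse_u)

text \<open>The coefficients of \<open>y\<close> lie in [0, 1], so \<open>u - y \<odot> y\<close> is
  in the cone and \<open>tau y y\<close> is at most \<open>tau u u\<close>; coercivity turns this
  into a bound on the norm.\<close>

lemma bounded_unit_interval: "bounded {y \<in> C. M y u \<le> 1}"
proof -
  obtain c where c: "c > 0" "\<And>v. c * (norm v * norm v) \<le> tau v v" using tau_coercive by blast
  have "norm y \<le> sqrt (tau u u / c)" if y: "y \<in> C" "M y u \<le> 1" for y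
  proof -
    obtain P f where P: "frame P" and yf: "y = (\<Sum>p\<in>P. f p *\<^sub>R p)" using spectral_decomposition by blast
    have u: "u = (\<Sum>p\<in>P. 1 *\<^sub>R p)" using frame_sum[OF P] by simp
    have f: "\<forall>p\<in>P. 0 \<le> f p" using y(1) unfolding yf cone_comb_iff[OF P] .
    have "M y u \<le> 1 \<longleftrightarrow> (\<forall>p\<in>P. f p \<le> 1 * 1)" unfolding yf by (subst u) (rule M_comb_le_iff[OF P], simp)
    then have "\<forall>p\<in>P. f p * f p \<le> 1" using y(2) f by (auto intro: mult_le_one)
    moreover have "u - y \<odot> y = (\<Sum>p\<in>P. (1 - f p * f p) *\<^sub>R p)"
      unfolding yf frame_comb_mult[OF P] by (subst u) (simp only: scaleR_diff_left sum_subtractf)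
    ultimately have "u - y \<odot> y \<in> C" using cone_comb_iff[OF P, of "\<lambda>p. 1 - f p * f p"] by simp
    then have "0 \<le> tau ((u - y \<odot> y) \<odot> u) u" by (rule cone_tau_nonneg)
    moreover have "tau (y \<odot> y) u = tau y y" by (simp add: tau_assoc)
    ultimately have "tau y y \<le> tau u u" by (simp add: tau_diff_left)
    then have "norm y * norm y \<le> tau u u / c" using c(2)[of y] c(1) by (simp add: field_simps)
    then show ?thesis by (intro real_le_rsqrt) (simp add: power2_eq_square)
  qed
  then show ?thesis by (intro boundedI) blast
qed

lemma compact_horo_params: "compact horo_params"
proof -
  have "horo_params \<subseteq> {y \<in> C. M y u \<le> 1} \<times> {y \<in> C. M y u \<le> 1}"
    by (auto simp: horo_params_def pair_gauge_u)
  then have "bounded horo_params"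
    by (rule bounded_subset[OF bounded_Times[OF bounded_unit_interval bounded_unit_interval]])
  moreover have "closed horo_params"
  proof -
    have m: "continuous_on UNIV (\<lambda>p. fst p \<odot> snd p)"
      using bil bilinear_conv_bounded_bilinear[of "(\<odot>)"]
      by (intro bounded_bilinear.continuous_on[of "(\<odot>)"] continuous_intros) auto
    have M: "continuous_on UNIV (\<lambda>p. M (f p) u)" if "continuous_on UNIV f" for f :: "'a \<times> 'a \<Rightarrow> 'a"
      using continuous_on_compose2[OF continuous_on_M[OF u_in_icone] that] by simp
    have "closed ((\<lambda>s. s *\<^sub>R u) ` {0..1::real})"
      by (intro compact_imp_closed compact_continuous_image continuous_intros compact_Icc)
    then have "closed ((\<lambda>p. fst p \<odot> snd p) -` ((\<lambda>s. s *\<^sub>R u) ` {0..1::real}))"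
      by (rule closed_vimage[OF _ m])
    moreover have "closed {p. max (M (fst p) u) (M (snd p) u) = 1}"
      by (intro closed_Collect_eq continuous_intros M)
    moreover have "horo_params = (C \<times> C) \<inter> {p. max (M (fst p) u) (M (snd p) u) = 1}
        \<inter> ((\<lambda>p. fst p \<odot> snd p) -` ((\<lambda>s. s *\<^sub>R u) ` {0..1::real}))"
      by (auto simp: horo_params_def pair_gauge_u)
    ultimately show ?thesis by (simp add: closed_Int closed_Times closed_cone)
  qed
  ultimately show ?thesis by (simp add: compact_eq_bounded_closed)
qed

lemma horo_params_nonzero: "(y, z) \<in> horo_params \<Longrightarrow> y \<noteq> 0 \<or> z \<noteq> 0"
  using u_in_icone by (auto simp: horo_params_def pair_gauge_u)

text \<open>A compact set in a Hausdorff space is closed. Continuity in the pair holds since the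
  gauge is positive on nonzero pairs, so the logarithm is continuous there.\<close>

lemma closedin_horo_forms:
  "closedin (pw_top (\<odot>)) ((\<lambda>(y, z). horo_form (\<odot>) u y z) ` horo_params)"
proof (rule compactin_imp_closedin)
  show "Hausdorff_space (pw_top (\<odot>))"
    unfolding pw_top_def by (simp add: Hausdorff_space_product_topology)
  have "continuous_map (top_of_set horo_params) (pw_top (\<odot>)) (\<lambda>(y, z). horo_form (\<odot>) u y z)"
    unfolding pw_top_def continuous_map_componentwise
  proof (intro conjI ballI)
    show "(\<lambda>(y, z). horo_form (\<odot>) u y z) ` topspace (top_of_set horo_params) \<subseteq> extensional C\<^sub>0"
      by (auto simp: horo_form_def)
    fix x assume x: "x \<in> C\<^sub>0"
    note ix = jinverse_in_icone[OF x]
    have "continuous_on horo_params (\<lambda>p. ln (pair_gauge (fst p) (snd p) x))"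
    proof (intro continuous_intros)
      show "continuous_on horo_params (\<lambda>p. pair_gauge (fst p) (snd p) x)"
        unfolding pair_gauge_def
        by (intro continuous_intros continuous_on_compose2[OF continuous_on_M[OF x]]
            continuous_on_compose2[OF continuous_on_M[OF ix]]) auto
      show "\<forall>p\<in>horo_params. pair_gauge (fst p) (snd p) x \<noteq> 0"
      proof
        fix p assume "p \<in> horo_params"
        then have "0 < pair_gauge (fst p) (snd p) x"
          using horo_params_nonzero[of "fst p" "snd p"] x by (intro pair_gauge_pos) (auto simp: horo_params_def)
        then show "pair_gauge (fst p) (snd p) x \<noteq> 0" by simp
      qed
    qed
    moreover have "(case p of (y, z) \<Rightarrow> horo_form (\<odot>) u y z) x = ln (pair_gauge (fst p) (snd p) x)"
      if "p \<in> horo_params" for p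
      using that x horo_params_nonzero[of "fst p" "snd p"]
      by (auto simp: horo_form_eq horo_params_def split: prod.splits)
    ultimately show "continuous_map (top_of_set horo_params) euclideanreal
        (\<lambda>p. (case p of (y, z) \<Rightarrow> horo_form (\<odot>) u y z) x)"
      by (simp cong: continuous_on_cong)
  qed
  then show "compactin (pw_top (\<odot>)) ((\<lambda>(y, z). horo_form (\<odot>) u y z) ` horo_params)"
    by (rule image_compactin[rotated]) (simp add: compactin_subtopology compact_horo_params)
qed

lemma hw_in_horo_forms:
  assumes w: "w \<in> C\<^sub>0"
  shows "hw (\<odot>) u w \<in> (\<lambda>(y, z). horo_form (\<odot>) u y z) ` horo_params"
proof -
  \<comment> \<open>This is exp (-d_T(u, w)): it makes the gauge at \<open>u\<close> equal to 1 and
    is at most 1 as distances are nonnegative.\<close>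
  define a where "a = 1 / pair_gauge w (jinverse w) u"
  note iw = jinverse_in_icone[OF w]
  have pos: "0 < pair_gauge w (jinverse w) u"
    using w u_in_icone icone_nonzero by (intro pair_gauge_pos icone_subset iw) auto
  have a: "0 < a" using pos by (simp add: a_def)
  have g1: "pair_gauge (a *\<^sub>R w) (a *\<^sub>R jinverse w) u = 1"
    using pos a by (simp add: pair_gauge_scale u_in_icone) (simp add: a_def)
  have "0 \<le> thompson (\<odot>) u w" using thompson_nonneg u_in_icone w by blast
  then have "a \<le> 1" using pos by (simp add: thompson_eq u_in_icone w a_def)
  then have "a * a \<in> {0..1}" using a by (simp add: mult_le_one)
  moreover have "(a *\<^sub>R w) \<odot> (a *\<^sub>R jinverse w) = (a * a) *\<^sub>R u" by (simp add: mult_jinverse[OF w])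
  ultimately have mem: "(a *\<^sub>R w, a *\<^sub>R jinverse w) \<in> horo_params"
    unfolding horo_params_def using g1 a w iw by (auto simp: cone_scale icone_subset)
  have "hw (\<odot>) u w = horo_form (\<odot>) u (a *\<^sub>R w) (a *\<^sub>R jinverse w)"
  proof
    fix x show "hw (\<odot>) u w x = horo_form (\<odot>) u (a *\<^sub>R w) (a *\<^sub>R jinverse w) x"
    proof (cases "x \<in> C\<^sub>0")
      case True
      have "hw (\<odot>) u w x = ln (pair_gauge (a *\<^sub>R w) (a *\<^sub>R jinverse w) x)"
        by (simp add: hw_eq[OF w True a] g1)
      then show ?thesis using mem horo_params_nonzero[OF mem] True
        by (subst horo_form_eq) (auto simp: horo_params_def)
    qed (simp add: hw_def horo_form_def)
  qed
  then show ?thesis using mem by (force intro: image_eqI)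
qed

lemma horofunction_imp_form:
  assumes "horofunction (\<odot>) u h"
  obtains y z where "y \<in> C" "z \<in> C" "y \<odot> z = 0" "max (M y u) (M z u) = 1" "h = horo_form (\<odot>) u y z"
proof -
  have "pw_top (\<odot>) closure_of (hw (\<odot>) u ` C\<^sub>0) \<subseteq> (\<lambda>(y, z). horo_form (\<odot>) u y z) ` horo_params"
    using hw_in_horo_forms by (intro closure_of_minimal closedin_horo_forms) blast
  then obtain y z where yz: "(y, z) \<in> horo_params" and h: "h = horo_form (\<odot>) u y z"
    using assms unfolding horofunction_def by auto
  then obtain s where *: "y \<in> C" "z \<in> C" "pair_gauge y z u = 1" "0 \<le> s" "y \<odot> z = s *\<^sub>R u"
    unfolding horo_params_def by auto
  show ?thesis
  proof (cases "s = 0")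
    case True
    then show ?thesis using that[of y z] * h by (simp add: pair_gauge_u)
  next
    case False
    then have s: "0 < s" using * by simp
    \<comment> \<open>From \<open>y \<odot> z = s u\<close>, the rescaled elements
      \<open>y / sqrt s\<close> and \<open>z / sqrt s\<close> are inverse to each other; the former
      is the internal point.\<close>
    define a where "a = sqrt s"
    have a: "0 < a" "a * a = s" using s by (simp_all add: a_def)
    have y0: "y \<in> C\<^sub>0" using s *(5) by (intro icone_if_mult_eq_u[OF *(1), of "(1/s) *\<^sub>R z"]) simp
    define w where "w = (1/a) *\<^sub>R y"
    have w: "w \<in> C\<^sub>0" unfolding w_def using y0 a by (intro icone_scale) auto
    have "jinverse w = (1/a) *\<^sub>R z"
      unfolding w_def using a *(5)
      by (intro jinverse_mult_unique icone_scale y0) (auto simp flip: a(2))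
    then have yz: "y = a *\<^sub>R w" "z = a *\<^sub>R jinverse w" using a by (simp_all add: w_def)
    have "h = hw (\<odot>) u w"
    proof
      fix x show "h x = hw (\<odot>) u w x"
      proof (cases "x \<in> C\<^sub>0")
        case True
        have "h x = ln (pair_gauge y z x)"
          unfolding h using True * icone_nonzero[OF y0] by (subst horo_form_eq) auto
        also have "\<dots> = hw (\<odot>) u w x" using *(3) unfolding yz by (simp add: hw_eq[OF w True a(1)])
        finally show ?thesis .
      qed (simp add: h hw_def horo_form_def)
    qed
    then show ?thesis using assms w unfolding horofunction_def by blast
  qed
qed

section \<open>Geodesics and Busemann points\<close>

text \<open>In a common frame of \<open>y\<close> and \<open>z\<close>, the curve scales the part of \<open>y\<close> by \<open>e\<^sup>t\<close> and that of
  \<open>z\<^sup>-\<^sup>1\<close> by \<open>e\<^sup>-\<^sup>t\<close>.\<close>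

lemma horo_form_is_busemann:
  assumes y: "y \<in> C" and z: "z \<in> C" and yz: "y \<odot> z = 0" and norm1: "max (M y u) (M z u) = 1"
  shows "busemann (\<odot>) u (horo_form (\<odot>) u y z)"
proof -
  have nz: "y \<noteq> 0 \<or> z \<noteq> 0" using norm1 u_in_icone by auto
  obtain P f g where P: "frame P" and yf: "y = (\<Sum>p\<in>P. f p *\<^sub>R p)" and zg: "z = (\<Sum>p\<in>P. g p *\<^sub>R p)"
    and f: "\<And>p. 0 \<le> f p" and g: "\<And>p. 0 \<le> g p" and fg: "\<And>p. f p = 0 \<or> g p = 0"
    by (rule common_frame[OF y z yz]) blast
  \<comment> \<open>Along \<open>p0\<close> the curve moves at full speed, which forces the distance
    up to \<open>t - s\<close>: through M(\<gamma> t/\<gamma> s) if \<open>f p0\<close> is positive,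
    and through M(\<gamma> s/\<gamma> t) otherwise.\<close>
  obtain p0 where p0: "p0 \<in> P" "0 < f p0 \<or> 0 < g p0"
  proof (rule ccontr)
    assume "\<not> thesis"
    then have "f p = 0 \<and> g p = 0" if "p \<in> P" for p
      using \<open>\<And>p0. \<lbrakk>p0 \<in> P; 0 < f p0 \<or> 0 < g p0\<rbrakk> \<Longrightarrow> thesis\<close> that f[of p] g[of p] by force
    then show False using nz unfolding yf zg by simp
  qed
  \<comment> \<open>Where both coefficients vanish the curve stays at 1; after scaling by
    \<open>exp (- t)\<close> this part disappears both from the curve and from its inverse.\<close>
  define a where "a p t = (if 0 < f p then f p * exp t else if 0 < g p then inverse (g p) * exp (- t) else 1)"
    for p t
  define \<gamma> where "\<gamma> t = (\<Sum>p\<in>P. a p t *\<^sub>R p)" for t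
  have a: "0 < a p t" for p t by (simp add: a_def)
  have \<gamma>: "\<gamma> t \<in> C\<^sub>0" for t unfolding \<gamma>_def icone_comb_iff[OF P] using a by blast
  have "\<forall>p\<in>P. a p t \<noteq> 0" for t using a[THEN less_imp_neq] by metis
  then have j\<gamma>: "jinverse (\<gamma> t) = (\<Sum>p\<in>P. inverse (a p t) *\<^sub>R p)" for t
    unfolding \<gamma>_def by (intro jinverse_comb[OF P])
  have dist: "thompson (\<odot>) (\<gamma> t) (\<gamma> s) = t - s" if st: "s \<le> t" for s t
  proof -
    have E: "exp (- t) \<le> exp (t - s) * exp (- s)" "exp (- s) = exp (t - s) * exp (- t)"
      "exp t = exp (t - s) * exp s" "exp s \<le> exp (t - s) * exp t" "1 \<le> exp (t - s)"
      using st by (simp_all flip: exp_add)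
    have scale: "c * r \<le> exp (t - s) * (c * r')" if "r \<le> exp (t - s) * r'" "0 < c" for c r r' :: real
      using mult_left_mono[OF that(1), of c] that(2) by (simp add: mult.left_commute)
    have E': "exp t \<le> exp (t - s) * exp s" "exp (- s) \<le> exp (t - s) * exp (- t)" using E(2,3) by simp_all
    have 1: "a p t \<le> exp (t - s) * a p s" "a p s \<le> exp (t - s) * a p t" for p
    proof -
      consider "0 < f p" | "\<not> 0 < f p" "0 < g p" | "\<not> 0 < f p" "\<not> 0 < g p" by blast
      then have "a p t \<le> exp (t - s) * a p s \<and> a p s \<le> exp (t - s) * a p t"
      proof cases
        case 1
        show ?thesis unfolding a_def using 1 scale[OF E'(1) 1] scale[OF E(4) 1] by simp
      next
        case 2
        then have "0 < inverse (g p)" by simp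
        from scale[OF E(1) this] scale[OF E'(2) this] show ?thesis unfolding a_def using 2 by simp
      next
        case 3
        then show ?thesis unfolding a_def using E(5) by simp
      qed
      then show "a p t \<le> exp (t - s) * a p s" "a p s \<le> exp (t - s) * a p t" by blast+
    qed
    have le: "M (\<gamma> t) (\<gamma> s) \<le> exp (t - s)" "M (\<gamma> s) (\<gamma> t) \<le> exp (t - s)"
      unfolding \<gamma>_def using 1 by (simp_all add: M_comb_le_iff[OF P] a)
    have "exp (t - s) \<le> M (\<gamma> t) (\<gamma> s) \<or> exp (t - s) \<le> M (\<gamma> s) (\<gamma> t)"
    proof (cases "0 < f p0")
      case True
      then have "exp (t - s) * a p0 s \<le> a p0 t" using E(3) by (simp add: a_def)
      then have "exp (t - s) \<le> M (\<gamma> t) (\<gamma> s)" unfolding \<gamma>_def by (rule M_comb_ge[OF P a p0(1)])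
      then show ?thesis ..
    next
      case False
      then have "exp (t - s) * a p0 t \<le> a p0 s" using E(2) p0(2) by (simp add: a_def)
      then have "exp (t - s) \<le> M (\<gamma> s) (\<gamma> t)" unfolding \<gamma>_def by (rule M_comb_ge[OF P a p0(1)])
      then show ?thesis ..
    qed
    then have "max (M (\<gamma> t) (\<gamma> s)) (M (\<gamma> s) (\<gamma> t)) = exp (t - s)" using le by auto
    moreover have "0 < M (\<gamma> t) (\<gamma> s)" "0 < M (\<gamma> s) (\<gamma> t)"
      using \<gamma> icone_nonzero by (auto intro!: M_pos icone_subset)
    ultimately show ?thesis unfolding thompson_def by (metis ln_max ln_exp)
  qed
  have geo: "almost_geodesic (\<odot>) {0..} \<gamma>"
    unfolding almost_geodesic_def
  proof (intro conjI allI impI)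
    show "\<exists>t\<in>{0..}. B < t" for B :: real by (rule bexI[of _ "\<bar>B\<bar> + 1"]) auto
    show "\<exists>N. \<forall>t\<in>{0..}. \<forall>s\<in>{0..}. N \<le> s \<and> s \<le> t \<longrightarrow>
        \<bar>thompson (\<odot>) (\<gamma> t) (\<gamma> s) + thompson (\<odot>) (\<gamma> s) (\<gamma> 0) - t\<bar> < \<epsilon>" if "0 < \<epsilon>" for \<epsilon>
      using that by (simp add: dist)
  qed (use \<gamma> in auto)
  have lim: "((\<lambda>t. exp (- t) *\<^sub>R \<gamma> t) \<longlongrightarrow> y) at_top" "((\<lambda>t. exp (- t) *\<^sub>R jinverse (\<gamma> t)) \<longlongrightarrow> z) at_top"
  proof -
    \<comment> \<open>The part of the curve belonging to the other element of the pair decays like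
      exp (-2 t) after scaling.\<close>
    have EE: "((\<lambda>t::real. c * (exp (- t) * exp (- t))) \<longlongrightarrow> 0) at_top" for c
      using tendsto_mult_right_zero[OF tendsto_mult_zero[OF tendsto_exp_neg tendsto_exp_neg]] .
    have "((\<lambda>t. exp (- t) * a p t) \<longlongrightarrow> f p) at_top" for p
    proof (cases "0 < f p")
      case True
      then have "exp (- t) * a p t = f p" for t by (simp add: a_def exp_minus field_simps)
      then show ?thesis by simp
    next
      case False
      then have "f p = 0" using f[of p] by simp
      then show ?thesis using EE[of "inverse (g p)"] tendsto_exp_neg
        by (cases "0 < g p") (simp_all add: a_def mult_ac)
    qed
    then have "((\<lambda>t. \<Sum>p\<in>P. (exp (- t) * a p t) *\<^sub>R p) \<longlongrightarrow> y) at_top"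
      unfolding yf by (intro tendsto_intros)
    then show "((\<lambda>t. exp (- t) *\<^sub>R \<gamma> t) \<longlongrightarrow> y) at_top" by (simp add: \<gamma>_def scaleR_sum_right)
    have "((\<lambda>t. exp (- t) * inverse (a p t)) \<longlongrightarrow> g p) at_top" for p
    proof (cases "0 < g p")
      case True
      then have "f p = 0" using fg[of p] by auto
      then have "exp (- t) * inverse (a p t) = g p" for t using True by (simp add: a_def exp_minus field_simps)
      then show ?thesis by simp
    next
      case False
      then have "g p = 0" using g[of p] by simp
      then show ?thesis using EE[of "inverse (f p)"] tendsto_exp_neg
        by (cases "0 < f p") (simp_all add: a_def exp_minus mult_ac)
    qed
    then have "((\<lambda>t. \<Sum>p\<in>P. (exp (- t) * inverse (a p t)) *\<^sub>R p) \<longlongrightarrow> z) at_top"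
      unfolding zg by (intro tendsto_intros)
    then show "((\<lambda>t. exp (- t) *\<^sub>R jinverse (\<gamma> t)) \<longlongrightarrow> z) at_top" by (simp add: j\<gamma> scaleR_sum_right)
  qed
  have limg: "((\<lambda>t. pair_gauge (exp (- t) *\<^sub>R \<gamma> t) (exp (- t) *\<^sub>R jinverse (\<gamma> t)) x) \<longlongrightarrow> pair_gauge y z x) at_top"
    if "x \<in> C\<^sub>0" for x
    unfolding pair_gauge_def using that jinverse_in_icone by (intro tendsto_max tendsto_M lim)
  have conv: "limitin (pw_top (\<odot>)) (\<lambda>t. hw (\<odot>) u (\<gamma> t)) (horo_form (\<odot>) u y z) at_top"
    unfolding pw_top_def limitin_componentwise
  proof (intro conjI ballI)
    fix x assume x: "x \<in> C\<^sub>0"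
    have g1: "pair_gauge y z u = 1" using norm1 by (simp add: pair_gauge_u)
    have "0 < pair_gauge y z x" using y z nz x by (intro pair_gauge_pos)
    then have "((\<lambda>t. ln (pair_gauge (exp (- t) *\<^sub>R \<gamma> t) (exp (- t) *\<^sub>R jinverse (\<gamma> t)) x)
        - ln (pair_gauge (exp (- t) *\<^sub>R \<gamma> t) (exp (- t) *\<^sub>R jinverse (\<gamma> t)) u))
        \<longlongrightarrow> ln (pair_gauge y z x) - ln (pair_gauge y z u)) at_top"
      using g1 by (intro tendsto_intros limg x u_in_icone) auto
    moreover have "hw (\<odot>) u (\<gamma> t) x = ln (pair_gauge (exp (- t) *\<^sub>R \<gamma> t) (exp (- t) *\<^sub>R jinverse (\<gamma> t)) x)
        - ln (pair_gauge (exp (- t) *\<^sub>R \<gamma> t) (exp (- t) *\<^sub>R jinverse (\<gamma> t)) u)" for t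
      by (rule hw_eq[OF \<gamma> x]) simp
    ultimately have "((\<lambda>t. hw (\<odot>) u (\<gamma> t) x) \<longlongrightarrow> ln (pair_gauge y z x)) at_top"
      by (simp add: g1)
    then show "limitin euclideanreal (\<lambda>t. hw (\<odot>) u (\<gamma> t) x) (horo_form (\<odot>) u y z x) at_top"
      using x by (simp add: horo_form_eq[OF y z nz])
  qed (simp_all add: horo_form_def hw_def)
  have "horo_form (\<odot>) u y z \<in> pw_top (\<odot>) closure_of (hw (\<odot>) u ` C\<^sub>0)"
  proof (rule limitin_closedin[OF conv closedin_closure_of])
    have "hw (\<odot>) u ` C\<^sub>0 \<subseteq> topspace (pw_top (\<odot>))"
      by (auto simp: pw_top_def hw_def)
    then have "hw (\<odot>) u (\<gamma> t) \<in> pw_top (\<odot>) closure_of (hw (\<odot>) u ` C\<^sub>0)" for t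
      using closure_of_subset \<gamma> by blast
    then show "\<forall>\<^sub>F t in at_top. hw (\<odot>) u (\<gamma> t) \<in> pw_top (\<odot>) closure_of (hw (\<odot>) u ` C\<^sub>0)" by simp
  qed simp
  moreover have "horo_form (\<odot>) u y z \<notin> hw (\<odot>) u ` C\<^sub>0"
  proof
    assume "horo_form (\<odot>) u y z \<in> hw (\<odot>) u ` C\<^sub>0"
    then obtain w where w: "w \<in> C\<^sub>0" and eq: "horo_form (\<odot>) u y z = hw (\<odot>) u w" by blast
    \<comment> \<open>The function is at most -t at \<gamma> t, while h_w is nowhere below -d_T(u,
      w); the summand 1 makes the contradiction strict.\<close>
    define t where "t = thompson (\<odot>) u w + 1"
    have "M y (\<gamma> t) \<le> exp (- t)"
    proof -
      have "f p \<le> exp (- t) * a p t" for p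
        using a[of p t] f[of p] by (cases "0 < f p") (auto simp: a_def exp_minus field_simps less_imp_le)
      then show ?thesis unfolding yf \<gamma>_def by (simp add: M_comb_le_iff[OF P] a)
    qed
    moreover have "M z (jinverse (\<gamma> t)) \<le> exp (- t)"
    proof -
      have "g p \<le> exp (- t) * inverse (a p t)" for p
        using a[of p t] g[of p] fg[of p]
        by (cases "0 < g p") (auto simp: a_def exp_minus field_simps less_imp_le)
      then show ?thesis unfolding zg j\<gamma> by (simp add: M_comb_le_iff[OF P] a)
    qed
    ultimately have "pair_gauge y z (\<gamma> t) \<le> exp (- t)" by (simp add: pair_gauge_def)
    moreover have "0 < pair_gauge y z (\<gamma> t)" using y z nz \<gamma> by (intro pair_gauge_pos)
    ultimately have "ln (pair_gauge y z (\<gamma> t)) \<le> - t" by (metis exp_gt_zero ln_exp ln_le_cancel_iff)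
    then have "hw (\<odot>) u w (\<gamma> t) \<le> - t" using \<gamma> by (simp add: horo_form_eq[OF y z nz] flip: eq)
    moreover have "hw (\<odot>) u w (\<gamma> t) = thompson (\<odot>) (\<gamma> t) w - thompson (\<odot>) u w"
      using \<gamma> by (simp add: hw_def)
    ultimately show False using thompson_nonneg[OF \<gamma>[of t] w] by (simp add: t_def)
  qed
  ultimately show ?thesis
    unfolding busemann_def horofunction_def
    using geo conv by (metis inf_at_top_atLeast)
qed

lemma horofunction_iff_form:
  "horofunction (\<odot>) u h \<longleftrightarrow>
     (\<exists>y z. y \<in> C \<and> z \<in> C \<and> y \<odot> z = 0 \<and> max (unorm (\<odot>) u y) (unorm (\<odot>) u z) = 1 \<and> h = horo_form (\<odot>) u y z)"
  (is "_ \<longleftrightarrow> ?form")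
  and horofunction_imp_busemann: "horofunction (\<odot>) u h \<Longrightarrow> busemann (\<odot>) u h"
proof -
  have 1: ?form if h: "horofunction (\<odot>) u h"
  proof -
    obtain y z where *: "y \<in> C" "z \<in> C" "y \<odot> z = 0" "max (M y u) (M z u) = 1" "h = horo_form (\<odot>) u y z"
      using horofunction_imp_form[OF h] .
    then show ?thesis using unorm_eq_M by (intro exI[of _ y] exI[of _ z]) simp
  qed
  have 2: "busemann (\<odot>) u h" if ?form
    using that unorm_eq_M horo_form_is_busemann by auto
  show "horofunction (\<odot>) u h \<longleftrightarrow> ?form" using 1 2 unfolding busemann_def by blast
  show "horofunction (\<odot>) u h \<Longrightarrow> busemann (\<odot>) u h" using 1 2 by blast
qed

end

theorem theorem3p2:
  fixes m :: "'a::euclidean_space \<Rightarrow> 'a \<Rightarrow> 'a" and u :: 'a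
  assumes "formally_real_jordan m u"
  shows "(\<forall>h. horofunction m u h \<longleftrightarrow>
            (\<exists>y z. y \<in> cone m \<and> z \<in> cone m \<and> m y z = 0 \<and>
                   max (unorm m u y) (unorm m u z) = 1 \<and> h = horo_form m u y z))
         \<and> (\<forall>h. horofunction m u h \<longrightarrow> busemann m u h)"
proof -
  interpret fr_jordan m u by unfold_locales (rule assms)
  show ?thesis using horofunction_iff_form horofunction_imp_busemann by blast
qed

end
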